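(* Let $(P_t)_{t>0}$ be an absolutely continuous strong Feller semigroup and $\Sigma\subset M$ a closed set. Let $1<p<+\infty$, $d>0$, and assume that for any $x\in\Sigma$ we have $$\liminf_{r\to0}\frac{\mu(B(x,r))}{r^d}>0$$ and $$\lim_{r\to0}\inf_{y,z\in B(x,r)}\varrho(y,z)^{d-2}g_\lambda(y,z)>0,$$ where for $y=z$ the product is read as $+\infty$ if $g_\lambda(y,y)=+\infty$ and as $0$ otherwise. (Equivalently, for $d>2$, the second condition says: there are $c_x,r_x>0$ with $g_\lambda(y,z)\ge c_x\,\varrho(y,z)^{2-d}$ for all $y,z\in B(x,r_x)$, with $\varrho(y,y)^{2-d}=+\infty$.) If $d>2p$ and $\mathcal{H}^{d-2p}(\Sigma)<+\infty$, then $\mathrm{Cap}_{2,p}(\Sigma)=0$. If $d=2p$ and $\mathcal{H}^{h_p}(\Sigma)<+\infty$, then we also have $\mathrm{Cap}_{2,p}(\Sigma)=0$.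
   Context: Setup: $(M,\varrho)$ is a locally compact separable metric space and $\mu$ is a nonnegative Radon measure on $M$ with full support; $L^p(M):=L^p(M,\mu)$. $(\mathcal{L},\mathcal{D}(\mathcal{L}))$ is a non-positive definite self-adjoint operator on $L^2(M)$ whose quadratic form $(\mathcal{E},\mathcal{D}(\mathcal{E}))$, $\mathcal{E}(f,g)=-\langle\mathcal{L}f,g\rangle_{L^2(M)}$, is a regular, strongly local Dirichlet form admitting a carré du champ (i.e. there is a nonnegative definite bilinear $L^1(M)$-valued map $\Gamma$ on $\mathcal{D}(\mathcal{E})\cap L^\infty(M)$ with $\frac12\{\mathcal{E}(fh,g)+\mathcal{E}(f,gh)-\mathcal{E}(fg,h)\}=\int_Mh\,\Gamma(f,g)d\mu$). $(P_t)_{t>0}$ is the symmetric Markov semigroup generated by $\mathcal{L}$. $(P_t)_{t>0}$ is strong Feller if $P_tf\in C_b(M)$ for all $t>0$, $f\in L^\infty(M)$; it is absolutely continuous if moreover for all $t>0$, $x\in M$ the measure $P_t(x,A):=P_t\mathbf{1}_A(x)$ has a density $p_{t,x}$ with respect to $\mu$. Then $p_t(x,y):=\int_Mp_{t/2,x}(z)p_{t/2,y}(z)\mu(dz)$ is the unique heat kernel of $(P_t)_{t>0}$ (jointly measurable, symmetric, satisfying $P_tf(x)=\int_Mp_t(x,y)f(y)\mu(dy)$ and the Chapman–Kolmogorov identity for all points). For fixed $\lambda>0$ set $g_\lambda(x,y):=\int_0^\infty e^{-\lambda t}p_t(x,y)\,dt\in[0,+\infty]$ and $G_\lambda f(x):=\int_Mg_\lambda(x,y)f(y)\mu(dy)$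 for nonnegative measurable $f$. $\mathrm{Cap}_{2,p}(E):=\inf\{\|f\|_{L^p(M)}^p:f\in L^p(M),\ f\ge0,\ G_\lambda f(x)\ge1\text{ for all }x\in E\}$ for $E\subset M$ ($+\infty$ if no such $f$ exists). Hausdorff measures: for a non-decreasing right-continuous function $h:[0,+\infty)\to[0,+\infty)$, strictly positive on $(0,+\infty)$ and doubling ($h(2r)\le c\,h(r)$), $\mathcal{H}^h(E):=\lim_{\delta\to0}\inf\sum_ih(\mathrm{diam}(E_i))$, the infimum over countable covers of $E$ by sets $E_i$ with $\mathrm{diam}(E_i)<\delta$; $\mathcal{H}^s$ is the case $h(r)=r^s$. $h_p(0):=0$ and $h_p(r):=(1+\log_+\frac1r)^{1-p}$, $r>0$, with $\log_+$ the nonnegative part of $\log$. *)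

theory Defs
  imports "HOL-Analysis.Analysis"
begin

section \<open>Lebesgue spaces\<close>

text \<open>
  Elements of the Lebesgue spaces are represented by measurable functions. Whatever lives on
  equivalence classes (subspaces, operators, forms) is required below to respect equality almost
  everywhere.
\<close>

definition Lp_space :: "'a measure \<Rightarrow> real \<Rightarrow> ('a \<Rightarrow> real) set" where
  "Lp_space \<mu> p = {f \<in> borel_measurable \<mu>. integrable \<mu> (\<lambda>x. \<bar>f x\<bar> powr p)}"

definition Lp_norm :: "'a measure \<Rightarrow> real \<Rightarrow> ('a \<Rightarrow> real) \<Rightarrow> real" where
  "Lp_norm \<mu> p f = (\<integral>x. \<bar>f x\<bar> powr p \<partial>\<mu>) powr (1 / p)"

definition Linf_space :: "'a measure \<Rightarrow> ('a \<Rightarrow> real) set" where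
  "Linf_space \<mu> = {f \<in> borel_measurable \<mu>. \<exists>C. AE x in \<mu>. \<bar>f x\<bar> \<le> C}"

definition L2_inner :: "'a measure \<Rightarrow> ('a \<Rightarrow> real) \<Rightarrow> ('a \<Rightarrow> real) \<Rightarrow> real" where
  "L2_inner \<mu> f g = (\<integral>x. f x * g x \<partial>\<mu>)"

definition L2_dist :: "'a measure \<Rightarrow> ('a \<Rightarrow> real) \<Rightarrow> ('a \<Rightarrow> real) \<Rightarrow> real" where
  "L2_dist \<mu> f g = Lp_norm \<mu> 2 (\<lambda>x. f x - g x)"

definition L2_subspace :: "'a measure \<Rightarrow> ('a \<Rightarrow> real) set \<Rightarrow> bool" where
  "L2_subspace \<mu> D \<longleftrightarrow>
     D \<subseteq> Lp_space \<mu> 2 \<and>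
     (\<lambda>_. 0) \<in> D \<and>
     (\<forall>f\<in>D. \<forall>g\<in>D. \<forall>a b. (\<lambda>x. a * f x + b * g x) \<in> D) \<and>
     (\<forall>f\<in>D. \<forall>g\<in>borel_measurable \<mu>. (AE x in \<mu>. f x = g x) \<longrightarrow> g \<in> D)"

definition L2_dense :: "'a measure \<Rightarrow> ('a \<Rightarrow> real) set \<Rightarrow> bool" where
  "L2_dense \<mu> D \<longleftrightarrow> (\<forall>f\<in>Lp_space \<mu> 2. \<forall>e>0. \<exists>g\<in>D. L2_dist \<mu> f g < e)"

definition L2_linear_on ::
  "'a measure \<Rightarrow> ('a \<Rightarrow> real) set \<Rightarrow> (('a \<Rightarrow> real) \<Rightarrow> ('a \<Rightarrow> real)) \<Rightarrow> bool" where
  "L2_linear_on \<mu> D A \<longleftrightarrow>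
     (\<forall>f\<in>D. A f \<in> Lp_space \<mu> 2) \<and>
     (\<forall>f\<in>D. \<forall>g\<in>D. (AE x in \<mu>. f x = g x) \<longrightarrow> (AE x in \<mu>. A f x = A g x)) \<and>
     (\<forall>f\<in>D. \<forall>g\<in>D. \<forall>a b.
        AE x in \<mu>. A (\<lambda>y. a * f y + b * g y) x = a * A f x + b * A g x)"


section \<open>Radon measures\<close>

text \<open>Separability of a metric space is expressed by the class \<open>second_countable_topology\<close>, which
  for metric spaces is the same property.\<close>

definition radon_measure :: "'a::metric_space measure \<Rightarrow> bool" where
  "radon_measure \<mu> \<longleftrightarrow>
     sets \<mu> = sets borel \<and>
     (\<forall>K. compact K \<longrightarrow> emeasure \<mu> K < \<infinity>) \<and>
     (\<forall>B\<in>sets \<mu>. emeasure \<mu> B = (SUP K\<in>{K. compact K \<and> K \<subseteq> B}. emeasure \<mu> K))"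

definition full_support :: "'a::metric_space measure \<Rightarrow> bool" where
  "full_support \<mu> \<longleftrightarrow> (\<forall>U. open U \<longrightarrow> U \<noteq> {} \<longrightarrow> emeasure \<mu> U > 0)"


section \<open>Self-adjoint operators and their quadratic forms\<close>

text \<open>The last two conjuncts say that the operator agrees with its Hilbert space adjoint (including
  the domains) and that it is non-positive definite.\<close>

definition nonpos_self_adjoint ::
  "'a measure \<Rightarrow> ('a \<Rightarrow> real) set \<Rightarrow> (('a \<Rightarrow> real) \<Rightarrow> ('a \<Rightarrow> real)) \<Rightarrow> bool" where
  "nonpos_self_adjoint \<mu> D L \<longleftrightarrow>
     L2_subspace \<mu> D \<and> L2_dense \<mu> D \<and> L2_linear_on \<mu> D L \<and>
     (\<forall>g\<in>Lp_space \<mu> 2. \<forall>h\<in>Lp_space \<mu> 2.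
        (\<forall>f\<in>D. L2_inner \<mu> (L f) g = L2_inner \<mu> f h) \<longleftrightarrow>
        (g \<in> D \<and> (AE x in \<mu>. L g x = h x))) \<and>
     (\<forall>f\<in>D. L2_inner \<mu> (L f) f \<le> 0)"

text \<open>The quadratic form of \<open>L\<close> is the closure of \<open>(f, g) \<mapsto> -\<langle>L f, g\<rangle>\<close> from the operator domain;
  its domain is the domain of the square root of \<open>-L\<close>.\<close>

definition form_approx ::
  "'a measure \<Rightarrow> ('a \<Rightarrow> real) set \<Rightarrow> (('a \<Rightarrow> real) \<Rightarrow> ('a \<Rightarrow> real)) \<Rightarrow>
    (nat \<Rightarrow> 'a \<Rightarrow> real) \<Rightarrow> ('a \<Rightarrow> real) \<Rightarrow> bool" where
  "form_approx \<mu> D L u f \<longleftrightarrow>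
     (\<forall>n. u n \<in> D) \<and>
     (\<lambda>n. L2_dist \<mu> (u n) f) \<longlonglongrightarrow> 0 \<and>
     (\<forall>e>0. \<exists>N. \<forall>m\<ge>N. \<forall>n\<ge>N.
        - L2_inner \<mu> (L (\<lambda>x. u m x - u n x)) (\<lambda>x. u m x - u n x) < e)"

definition form_domain ::
  "'a measure \<Rightarrow> ('a \<Rightarrow> real) set \<Rightarrow> (('a \<Rightarrow> real) \<Rightarrow> ('a \<Rightarrow> real)) \<Rightarrow> ('a \<Rightarrow> real) set" where
  "form_domain \<mu> D L = {f \<in> Lp_space \<mu> 2. \<exists>u. form_approx \<mu> D L u f}"

definition op_form ::
  "'a measure \<Rightarrow> ('a \<Rightarrow> real) set \<Rightarrow> (('a \<Rightarrow> real) \<Rightarrow> ('a \<Rightarrow> real)) \<Rightarrow>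
    ('a \<Rightarrow> real) \<Rightarrow> ('a \<Rightarrow> real) \<Rightarrow> real" where
  "op_form \<mu> D L f g = (THE c. \<forall>u v. form_approx \<mu> D L u f \<longrightarrow> form_approx \<mu> D L v g \<longrightarrow>
     (\<lambda>n. - L2_inner \<mu> (L (u n)) (v n)) \<longlonglongrightarrow> c)"


section \<open>Dirichlet forms\<close>

definition form_dist ::
  "'a measure \<Rightarrow> (('a \<Rightarrow> real) \<Rightarrow> ('a \<Rightarrow> real) \<Rightarrow> real) \<Rightarrow>
    ('a \<Rightarrow> real) \<Rightarrow> ('a \<Rightarrow> real) \<Rightarrow> real" where
  "form_dist \<mu> E f g =
     sqrt (E (\<lambda>x. f x - g x) (\<lambda>x. f x - g x) + (L2_dist \<mu> f g)\<^sup>2)"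

definition dirichlet_form ::
  "'a measure \<Rightarrow> ('a \<Rightarrow> real) set \<Rightarrow> (('a \<Rightarrow> real) \<Rightarrow> ('a \<Rightarrow> real) \<Rightarrow> real) \<Rightarrow> bool" where
  "dirichlet_form \<mu> F E \<longleftrightarrow>
     L2_subspace \<mu> F \<and> L2_dense \<mu> F \<and>
     (\<forall>f\<in>F. \<forall>g\<in>F. \<forall>h\<in>F. (AE x in \<mu>. f x = g x) \<longrightarrow> E f h = E g h) \<and>
     (\<forall>f\<in>F. \<forall>g\<in>F. \<forall>h\<in>F. \<forall>a b. E (\<lambda>x. a * f x + b * g x) h = a * E f h + b * E g h) \<and>
     (\<forall>f\<in>F. \<forall>g\<in>F. E f g = E g f) \<and>
     (\<forall>f\<in>F. 0 \<le> E f f) \<and>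
     (\<forall>u. (\<forall>n. u n \<in> F) \<longrightarrow> (\<forall>e>0. \<exists>N. \<forall>m\<ge>N. \<forall>n\<ge>N. form_dist \<mu> E (u m) (u n) < e) \<longrightarrow>
        (\<exists>f\<in>F. (\<lambda>n. form_dist \<mu> E (u n) f) \<longlonglongrightarrow> 0)) \<and>
     (\<forall>f\<in>F. (\<lambda>x. min (max (f x) 0) 1) \<in> F \<and>
        E (\<lambda>x. min (max (f x) 0) 1) (\<lambda>x. min (max (f x) 0) 1) \<le> E f f)"

definition Cc :: "('a::metric_space \<Rightarrow> real) set" where
  "Cc = {f. continuous_on UNIV f \<and> compact (closure {x. f x \<noteq> 0})}"

definition regular_form ::
  "'a::metric_space measure \<Rightarrow> ('a \<Rightarrow> real) set \<Rightarrow> (('a \<Rightarrow> real) \<Rightarrow> ('a \<Rightarrow> real) \<Rightarrow> real) \<Rightarrow> bool" where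
  "regular_form \<mu> F E \<longleftrightarrow>
     (\<forall>f\<in>F. \<forall>e>0. \<exists>g\<in>F \<inter> Cc. form_dist \<mu> E f g < e) \<and>
     (\<forall>f\<in>Cc. \<forall>e>0. \<exists>g\<in>F \<inter> Cc. \<forall>x. \<bar>f x - g x\<bar> < e)"

definition ess_support :: "'a::metric_space measure \<Rightarrow> ('a \<Rightarrow> real) \<Rightarrow> 'a set" where
  "ess_support \<mu> f = - \<Union>{U. open U \<and> (AE x in \<mu>. x \<in> U \<longrightarrow> f x = 0)}"

definition strongly_local ::
  "'a::metric_space measure \<Rightarrow> ('a \<Rightarrow> real) set \<Rightarrow> (('a \<Rightarrow> real) \<Rightarrow> ('a \<Rightarrow> real) \<Rightarrow> real) \<Rightarrow> bool" where
  "strongly_local \<mu> F E \<longleftrightarrow>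
     (\<forall>f\<in>F. \<forall>g\<in>F. compact (ess_support \<mu> f) \<longrightarrow> compact (ess_support \<mu> g) \<longrightarrow>
        (\<exists>U c. open U \<and> ess_support \<mu> f \<subseteq> U \<and> (AE x in \<mu>. x \<in> U \<longrightarrow> g x = c)) \<longrightarrow>
        E f g = 0)"

definition admits_carre_du_champ ::
  "'a measure \<Rightarrow> ('a \<Rightarrow> real) set \<Rightarrow> (('a \<Rightarrow> real) \<Rightarrow> ('a \<Rightarrow> real) \<Rightarrow> real) \<Rightarrow> bool" where
  "admits_carre_du_champ \<mu> F E \<longleftrightarrow>
     (\<exists>\<Gamma> :: ('a \<Rightarrow> real) \<Rightarrow> ('a \<Rightarrow> real) \<Rightarrow> ('a \<Rightarrow> real).
        let B = F \<inter> Linf_space \<mu> in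
        (\<forall>f\<in>B. \<forall>g\<in>B. \<Gamma> f g \<in> Lp_space \<mu> 1) \<and>
        (\<forall>f\<in>B. \<forall>f'\<in>B. \<forall>g\<in>B. \<forall>g'\<in>B.
           (AE x in \<mu>. f x = f' x) \<longrightarrow> (AE x in \<mu>. g x = g' x) \<longrightarrow>
           (AE x in \<mu>. \<Gamma> f g x = \<Gamma> f' g' x)) \<and>
        (\<forall>f\<in>B. \<forall>g\<in>B. \<forall>h\<in>B. \<forall>a b.
           (AE x in \<mu>. \<Gamma> (\<lambda>y. a * f y + b * g y) h x = a * \<Gamma> f h x + b * \<Gamma> g h x) \<and>
           (AE x in \<mu>. \<Gamma> h (\<lambda>y. a * f y + b * g y) x = a * \<Gamma> h f x + b * \<Gamma> h g x)) \<and>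
        (\<forall>f\<in>B. AE x in \<mu>. 0 \<le> \<Gamma> f f x) \<and>
        (\<forall>f\<in>B. \<forall>g\<in>B. \<forall>h\<in>B.
           (1 / 2) * (E (\<lambda>x. f x * h x) g + E f (\<lambda>x. g x * h x) - E (\<lambda>x. f x * g x) h) =
           (\<integral>x. h x * \<Gamma> f g x \<partial>\<mu>)))"


section \<open>The semigroup and its heat kernel\<close>

text \<open>Symmetric Markov strongly continuous contraction semigroup on \<open>L\<^sup>2\<close> whose infinitesimal
  generator, domain included, is the operator \<open>L\<close> on \<open>D\<close>.\<close>

definition markov_semigroup_generated_by ::
  "'a measure \<Rightarrow> ('a \<Rightarrow> real) set \<Rightarrow> (('a \<Rightarrow> real) \<Rightarrow> ('a \<Rightarrow> real)) \<Rightarrow>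
    (real \<Rightarrow> ('a \<Rightarrow> real) \<Rightarrow> ('a \<Rightarrow> real)) \<Rightarrow> bool" where
  "markov_semigroup_generated_by \<mu> D L P \<longleftrightarrow>
     (\<forall>t>0. L2_linear_on \<mu> (Lp_space \<mu> 2) (P t)) \<and>
     (\<forall>t>0. \<forall>f\<in>Lp_space \<mu> 2. Lp_norm \<mu> 2 (P t f) \<le> Lp_norm \<mu> 2 f) \<and>
     (\<forall>s>0. \<forall>t>0. \<forall>f\<in>Lp_space \<mu> 2. AE x in \<mu>. P (s + t) f x = P s (P t f) x) \<and>
     (\<forall>f\<in>Lp_space \<mu> 2. ((\<lambda>t. L2_dist \<mu> (P t f) f) \<longlongrightarrow> 0) (at_right 0)) \<and>
     (\<forall>t>0. \<forall>f\<in>Lp_space \<mu> 2. \<forall>g\<in>Lp_space \<mu> 2. L2_inner \<mu> (P t f) g = L2_inner \<mu> f (P t g)) \<and>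
     (\<forall>t>0. \<forall>f\<in>Lp_space \<mu> 2. (AE x in \<mu>. 0 \<le> f x \<and> f x \<le> 1) \<longrightarrow>
        (AE x in \<mu>. 0 \<le> P t f x \<and> P t f x \<le> 1)) \<and>
     (\<forall>f\<in>Lp_space \<mu> 2. \<forall>h\<in>Lp_space \<mu> 2.
        ((\<lambda>t. L2_dist \<mu> (\<lambda>x. (P t f x - f x) / t) h) \<longlongrightarrow> 0) (at_right 0) \<longleftrightarrow>
        (f \<in> D \<and> (AE x in \<mu>. L f x = h x)))"

text \<open>The semigroup acts on \<open>L\<^sup>\<infinity>\<close> as the dual of its action on \<open>L\<^sup>1\<close>: \<open>g\<close> is a representative
  of \<open>P\<^sub>t f\<close>.\<close>

definition Linf_version ::
  "'a measure \<Rightarrow> (real \<Rightarrow> ('a \<Rightarrow> real) \<Rightarrow> ('a \<Rightarrow> real)) \<Rightarrow> real \<Rightarrow>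
    ('a \<Rightarrow> real) \<Rightarrow> ('a \<Rightarrow> real) \<Rightarrow> bool" where
  "Linf_version \<mu> P t f g \<longleftrightarrow> g \<in> Linf_space \<mu> \<and>
     (\<forall>h \<in> Lp_space \<mu> 1 \<inter> Lp_space \<mu> 2. (\<integral>x. g x * h x \<partial>\<mu>) = (\<integral>x. f x * P t h x \<partial>\<mu>))"

definition Cb_version ::
  "'a::metric_space measure \<Rightarrow> (real \<Rightarrow> ('a \<Rightarrow> real) \<Rightarrow> ('a \<Rightarrow> real)) \<Rightarrow> real \<Rightarrow>
    ('a \<Rightarrow> real) \<Rightarrow> ('a \<Rightarrow> real) \<Rightarrow> bool" where
  "Cb_version \<mu> P t f g \<longleftrightarrow>
     continuous_on UNIV g \<and> bounded (range g) \<and> Linf_version \<mu> P t f g"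

definition strong_feller ::
  "'a::metric_space measure \<Rightarrow> (real \<Rightarrow> ('a \<Rightarrow> real) \<Rightarrow> ('a \<Rightarrow> real)) \<Rightarrow> bool" where
  "strong_feller \<mu> P \<longleftrightarrow> (\<forall>t>0. \<forall>f\<in>Linf_space \<mu>. \<exists>g. Cb_version \<mu> P t f g)"

text \<open>If the measure has full support, a continuous representative is unique, and point values of
  \<open>P\<^sub>t f\<close> refer to it.\<close>

definition transition_prob ::
  "'a::metric_space measure \<Rightarrow> (real \<Rightarrow> ('a \<Rightarrow> real) \<Rightarrow> ('a \<Rightarrow> real)) \<Rightarrow>
    real \<Rightarrow> 'a \<Rightarrow> 'a set \<Rightarrow> real" where
  "transition_prob \<mu> P t x A = (THE g. Cb_version \<mu> P t (indicator A) g) x"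

definition is_transition_density ::
  "'a::metric_space measure \<Rightarrow> (real \<Rightarrow> ('a \<Rightarrow> real) \<Rightarrow> ('a \<Rightarrow> real)) \<Rightarrow>
    real \<Rightarrow> 'a \<Rightarrow> ('a \<Rightarrow> ennreal) \<Rightarrow> bool" where
  "is_transition_density \<mu> P t x q \<longleftrightarrow> q \<in> borel_measurable \<mu> \<and>
     (\<forall>A\<in>sets \<mu>. ennreal (transition_prob \<mu> P t x A) = (\<integral>\<^sup>+z\<in>A. q z \<partial>\<mu>))"

definition abs_cont_strong_feller ::
  "'a::metric_space measure \<Rightarrow> (real \<Rightarrow> ('a \<Rightarrow> real) \<Rightarrow> ('a \<Rightarrow> real)) \<Rightarrow> bool" where
  "abs_cont_strong_feller \<mu> P \<longleftrightarrow> strong_feller \<mu> P \<and>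
     (\<forall>t>0. \<forall>x. \<exists>q. is_transition_density \<mu> P t x q)"

definition transition_density ::
  "'a::metric_space measure \<Rightarrow> (real \<Rightarrow> ('a \<Rightarrow> real) \<Rightarrow> ('a \<Rightarrow> real)) \<Rightarrow>
    real \<Rightarrow> 'a \<Rightarrow> 'a \<Rightarrow> ennreal" where
  "transition_density \<mu> P t x = (SOME q. is_transition_density \<mu> P t x q)"

text \<open>A density is determined up to null sets, so the heat kernel, which may take the value
  \<open>\<infinity>\<close>, does not depend on the choice above.\<close>

definition heat_kernel ::
  "'a::metric_space measure \<Rightarrow> (real \<Rightarrow> ('a \<Rightarrow> real) \<Rightarrow> ('a \<Rightarrow> real)) \<Rightarrow>
    real \<Rightarrow> 'a \<Rightarrow> 'a \<Rightarrow> ennreal" where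
  "heat_kernel \<mu> P t x y =
     (\<integral>\<^sup>+z. transition_density \<mu> P (t / 2) x z * transition_density \<mu> P (t / 2) y z \<partial>\<mu>)"


section \<open>Resolvent kernel and capacity\<close>

definition resolvent_kernel ::
  "'a::metric_space measure \<Rightarrow> (real \<Rightarrow> ('a \<Rightarrow> real) \<Rightarrow> ('a \<Rightarrow> real)) \<Rightarrow>
    real \<Rightarrow> 'a \<Rightarrow> 'a \<Rightarrow> ennreal" where
  "resolvent_kernel \<mu> P l x y =
     (\<integral>\<^sup>+t\<in>{0<..}. ennreal (exp (- l * t)) * heat_kernel \<mu> P t x y \<partial>lborel)"

definition resolvent_op ::
  "'a::metric_space measure \<Rightarrow> (real \<Rightarrow> ('a \<Rightarrow> real) \<Rightarrow> ('a \<Rightarrow> real)) \<Rightarrow>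
    real \<Rightarrow> ('a \<Rightarrow> real) \<Rightarrow> 'a \<Rightarrow> ennreal" where
  "resolvent_op \<mu> P l f x = (\<integral>\<^sup>+y. resolvent_kernel \<mu> P l x y * ennreal (f y) \<partial>\<mu>)"

definition capacity2 ::
  "'a::metric_space measure \<Rightarrow> (real \<Rightarrow> ('a \<Rightarrow> real) \<Rightarrow> ('a \<Rightarrow> real)) \<Rightarrow>
    real \<Rightarrow> real \<Rightarrow> 'a set \<Rightarrow> ennreal" where
  "capacity2 \<mu> P l p S =
     (INF f \<in> {f \<in> Lp_space \<mu> p. (AE x in \<mu>. 0 \<le> f x) \<and> (\<forall>x\<in>S. 1 \<le> resolvent_op \<mu> P l f x)}.
        ennreal (Lp_norm \<mu> p f powr p))"

text \<open>On the diagonal the product is \<open>\<infinity>\<close> or \<open>0\<close>, according to whether the kernel is infinite.\<close>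

definition scaled_resolvent_kernel ::
  "'a::metric_space measure \<Rightarrow> (real \<Rightarrow> ('a \<Rightarrow> real) \<Rightarrow> ('a \<Rightarrow> real)) \<Rightarrow>
    real \<Rightarrow> real \<Rightarrow> 'a \<Rightarrow> 'a \<Rightarrow> ennreal" where
  "scaled_resolvent_kernel \<mu> P l d y z =
     (if y = z then (if resolvent_kernel \<mu> P l y y = \<infinity> then \<infinity> else 0)
      else ennreal (dist y z powr (d - 2)) * resolvent_kernel \<mu> P l y z)"


section \<open>Hausdorff measures\<close>

text \<open>Sets of a cover are required to be bounded because \<open>diameter\<close> is only meaningful then. Empty
  sets contribute nothing, so that sequences also encode finite covers when \<open>h 0 > 0\<close>.\<close>

definition hausdorff_premeasure ::
  "(real \<Rightarrow> real) \<Rightarrow> real \<Rightarrow> 'a::metric_space set \<Rightarrow> ennreal" where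
  "hausdorff_premeasure h \<delta> S =
     (INF C \<in> {C :: nat \<Rightarrow> 'a set. S \<subseteq> (\<Union>i. C i) \<and> (\<forall>i. bounded (C i) \<and> diameter (C i) < \<delta>)}.
        \<Sum>i. if C i = {} then 0 else ennreal (h (diameter (C i))))"

definition hausdorff_measure :: "(real \<Rightarrow> real) \<Rightarrow> 'a::metric_space set \<Rightarrow> ennreal" where
  "hausdorff_measure h S = Lim (at_right 0) (\<lambda>\<delta>. hausdorff_premeasure h \<delta> S)"

definition log_gauge :: "real \<Rightarrow> real \<Rightarrow> real" where
  "log_gauge p r = (if r = 0 then 0 else (1 + max 0 (ln (1 / r))) powr (1 - p))"

end

theory Submission
  imports Defs "HOL-Real_Asymp.Real_Asymp"
begin

text \<open>
  The proof rests on three facts: the volume of balls centred in \<open>S\<close> is at least of order \<open>r\<^sup>d\<close>,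
  the kernel \<open>g\<^sub>\<lambda>\<close> is locally at least of order \<open>\<rho>\<^bsup>2-d\<^esup>\<close>, and \<open>\<mu>\<close> is locally finite. Potentials are
  read as lower integrals with an arbitrary kernel \<open>k\<close> and estimated from below by monotonicity and
  superadditivity. A set is called polar if there are nonnegative \<open>f\<close> with arbitrarily small
  \<open>\<integral> f\<^sup>p d\<mu>\<close> whose potential is at least 1 on the set; polar sets are stable under countable unions.

  The points at which the potential of a piece of \<open>\<mu>\<close> of finite mass is infinite form a polar set: a
  small multiple of an indicator function is a test function. At every other point of \<open>S\<close> the kernel
  bound turns finiteness of that potential into the upper bound \<open>\<mu>(B(x,r)) \<le> C r\<^bsup>d-2\<^esup>\<close>. A countable
  decomposition makes all constants uniform (lemma \<open>polar_if_uniformly_regular_parts_polar\<close>).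

  On a uniform part \<open>A\<close>, a ball \<open>B(x,r)\<close> has a test function \<open>f = a w\<^bsup>-(d-2)/(p-1)\<^esup>\<close> on \<open>B(x,R)\<close>, where
  \<open>w = max \<rho>(x,\<cdot>) r\<close>. Normalising by \<open>Z = \<integral> w\<^bsup>-(d-2)p/(p-1)\<^esup>\<close> over \<open>B(x,R)\<close> gives \<open>\<integral> f\<^sup>p = const Z\<^bsup>1-p\<^esup>\<close>,
  and since \<open>1 - p < 0\<close> a lower bound on volumes suffices (lemma \<open>ball_test_function\<close>). With \<open>R = r\<close>
  this is \<open>O(r\<^bsup>d-2p\<^esup>)\<close>; for \<open>d = 2p\<close> and \<open>R = sqrt r\<close>, \<open>Z\<close> is at least of order \<open>log(1/r)\<close> and one gets
  \<open>O(h\<^sub>p(r))\<close>. Combining the test functions of the balls of a cover of \<open>A\<close> therefore produces functions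
  with bounded \<open>p\<close>-energy and potential at least 1 on \<open>A\<close>.

  Finite Hausdorff measure only bounds the energies. They are made small by using that the supports
  have small measure: by the upper volume bound \<open>\<mu>(B(x,R)) = o(h(r))\<close> in both cases, so the supports
  shrink as the covers get finer. Hence \<open>N\<close> of these functions can be chosen almost disjointly
  supported; their sum has energy \<open>O(N)\<close>, their average has energy \<open>O(N\<^bsup>1-p\<^esup>)\<close>, and the potential of the
  average is still at least 1 on \<open>A\<close> (lemma \<open>polar_if_shrinking_test_functions\<close>).
\<close>

section \<open>Lower integrals and absolute continuity of the integral\<close>

text \<open>
  For functions that are not measurable the nonnegative integral is a lower integral. It is then no
  longer additive, but one inequality survives, and it is the one that bounds potentials from below.
\<close>

lemma nn_integral_superadditive:
  fixes f g :: "'a \<Rightarrow> ennreal"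
  shows "(\<integral>\<^sup>+x. f x \<partial>M) + (\<integral>\<^sup>+x. g x \<partial>M) \<le> (\<integral>\<^sup>+x. f x + g x \<partial>M)"
proof -
  let ?A = "{s. simple_function M s \<and> s \<le> f}" and ?B = "{s. simple_function M s \<and> s \<le> g}"
  have ne: "?A \<noteq> {}" "?B \<noteq> {}"
    by (auto intro!: exI[of _ "\<lambda>_. 0"] simp: le_fun_def)
  have st: "integral\<^sup>S M s + integral\<^sup>S M t \<le> (\<integral>\<^sup>+x. f x + g x \<partial>M)"
    if "s \<in> ?A" "t \<in> ?B" for s t
  proof -
    have "integral\<^sup>S M s + integral\<^sup>S M t = integral\<^sup>S M (\<lambda>x. s x + t x)"
      using that by (intro simple_integral_add[symmetric]) auto
    also have "\<dots> \<le> (\<integral>\<^sup>+x. f x + g x \<partial>M)"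
      unfolding nn_integral_def using that
      by (intro SUP_upper) (auto simp: le_fun_def intro: add_mono)
    finally show ?thesis .
  qed
  show ?thesis
    unfolding nn_integral_def[of M f] nn_integral_def[of M g]
    unfolding ennreal_SUP_add_left[OF ne(1), symmetric] ennreal_SUP_add_right[OF ne(2)]
    using st by (intro SUP_least)
qed

lemma nn_integral_mult_le:
  fixes f :: "'a \<Rightarrow> ennreal"
  shows "c * (\<integral>\<^sup>+x. f x \<partial>M) \<le> (\<integral>\<^sup>+x. c * f x \<partial>M)"
proof -
  have "c * integral\<^sup>S M s \<le> (\<integral>\<^sup>+x. c * f x \<partial>M)" if "simple_function M s" "s \<le> f" for s
  proof -
    have "c * integral\<^sup>S M s = integral\<^sup>S M (\<lambda>x. c * s x)"
      using that by (intro simple_integral_mult[symmetric]) auto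
    also have "\<dots> \<le> (\<integral>\<^sup>+x. c * f x \<partial>M)"
      unfolding nn_integral_def using that
      by (intro SUP_upper) (auto simp: le_fun_def intro: mult_left_mono)
    finally show ?thesis .
  qed
  then show ?thesis
    unfolding nn_integral_def[of M f] SUP_mult_left_ennreal by (intro SUP_least) auto
qed

text \<open>
  Truncate \<open>u\<close> at a height \<open>n\<close> that leaves an excess of integral at most \<open>\<epsilon>/2\<close>; on a set of measure
  at most \<open>\<eta>\<close> the truncation contributes at most \<open>n \<eta>\<close>.
\<close>

lemma nn_integral_small_on_small_sets:
  assumes [measurable]: "u \<in> borel_measurable M" and fin: "(\<integral>\<^sup>+x. u x \<partial>M) < \<infinity>" and "\<epsilon> > 0"
  obtains \<eta> :: real where "\<eta> > 0"
    and "\<And>T. T \<in> sets M \<Longrightarrow> emeasure M T \<le> ennreal \<eta> \<Longrightarrow> (\<integral>\<^sup>+x\<in>T. u x \<partial>M) \<le> ennreal \<epsilon>"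
proof -
  define v where "v n x = min (u x) (of_nat n)" for n :: nat and x
  have [measurable]: "v n \<in> borel_measurable M" for n
    unfolding v_def by measurable
  have vu: "v n x \<le> u x" for n x by (simp add: v_def)
  have sup: "(SUP n. v n x) = u x" if ux: "u x < \<infinity>" for x
  proof (rule antisym)
    show "(SUP n. v n x) \<le> u x" by (intro SUP_least vu)
    obtain n :: nat where "u x < of_nat n"
      using ux ennreal_Ex_less_of_nat[of "u x"] by auto
    then have "u x = v n x" by (simp add: v_def)
    then show "u x \<le> (SUP n. v n x)" by (metis SUP_upper UNIV_I)
  qed
  have "AE x in M. u x \<noteq> \<infinity>"
    using fin by (intro nn_integral_PInf_AE) auto
  then have "(\<integral>\<^sup>+x. u x \<partial>M) = (\<integral>\<^sup>+x. (SUP n. v n x) \<partial>M)"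
    by (intro nn_integral_cong_AE) (auto simp: sup top.not_eq_extremum elim!: eventually_mono)
  also have "\<dots> = (SUP n. \<integral>\<^sup>+x. v n x \<partial>M)"
    by (intro nn_integral_monotone_convergence_SUP)
       (auto simp: incseq_def le_fun_def v_def min_le_iff_disj intro: order_trans[OF min.cobounded2])
  finally have eq: "(\<integral>\<^sup>+x. u x \<partial>M) = (SUP n. \<integral>\<^sup>+x. v n x \<partial>M)" .
  have "(\<integral>\<^sup>+x. u x \<partial>M) \<le> (\<integral>\<^sup>+x. v n x \<partial>M) + ennreal (\<epsilon>/2)
        \<Longrightarrow> thesis" for n
  proof -
    assume le: "(\<integral>\<^sup>+x. u x \<partial>M) \<le> (\<integral>\<^sup>+x. v n x \<partial>M) + ennreal (\<epsilon>/2)"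
    have vfin: "(\<integral>\<^sup>+x. v n x \<partial>M) < \<infinity>"
      using nn_integral_mono[of M "v n" u] vu fin by (auto intro: le_less_trans)
    have "(\<integral>\<^sup>+x. u x - v n x \<partial>M) = (\<integral>\<^sup>+x. u x \<partial>M) - (\<integral>\<^sup>+x. v n x \<partial>M)"
      using vfin vu by (intro nn_integral_diff) auto
    also have "\<dots> \<le> ennreal (\<epsilon>/2)"
      using le vfin by (simp add: ennreal_minus_le_iff less_top)
    finally have diff: "(\<integral>\<^sup>+x. u x - v n x \<partial>M) \<le> ennreal (\<epsilon>/2)" .
    show thesis
    proof (rule that[of "\<epsilon> / (2 * (real n + 1))"])
      show "\<epsilon> / (2 * (real n + 1)) > 0" using \<open>\<epsilon> > 0\<close> by simp
      fix T assume [measurable]: "T \<in> sets M" and T: "emeasure M T \<le> ennreal (\<epsilon> / (2 * (real n + 1)))"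
      have "(\<integral>\<^sup>+x\<in>T. u x \<partial>M) \<le> (\<integral>\<^sup>+x. (u x - v n x) + of_nat n * indicator T x \<partial>M)"
      proof (rule nn_integral_mono)
        fix x
        have "u x \<le> (u x - v n x) + v n x" using vu[of n x] by (simp add: diff_add_cancel_ennreal)
        also have "\<dots> \<le> (u x - v n x) + of_nat n" by (simp add: v_def add_left_mono)
        finally show "u x * indicator T x \<le> (u x - v n x) + of_nat n * indicator T x"
          by (auto simp: indicator_def)
      qed
      also have "\<dots> = (\<integral>\<^sup>+x. u x - v n x \<partial>M) + of_nat n * emeasure M T"
        by (simp add: nn_integral_add nn_integral_cmult)
      also have "\<dots> \<le> ennreal (\<epsilon>/2) + of_nat n * ennreal (\<epsilon> / (2 * (real n + 1)))"
        using diff T by (intro add_mono mult_left_mono) auto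
      also have "of_nat n * ennreal (\<epsilon> / (2 * (real n + 1))) = ennreal (real n * (\<epsilon> / (2 * (real n + 1))))"
        by (subst ennreal_mult) (use \<open>\<epsilon> > 0\<close> in \<open>auto simp: ennreal_of_nat_eq_real_of_nat\<close>)
      also have "ennreal (\<epsilon>/2) + \<dots> \<le> ennreal \<epsilon>"
        using \<open>\<epsilon> > 0\<close> by (subst ennreal_plus[symmetric]) (auto intro!: ennreal_leI simp: field_simps)
      finally show "(\<integral>\<^sup>+x\<in>T. u x \<partial>M) \<le> ennreal \<epsilon>" by (simp add: add_left_mono)
    qed
  qed
  moreover have "\<exists>n. (\<integral>\<^sup>+x. u x \<partial>M) \<le> (\<integral>\<^sup>+x. v n x \<partial>M) + ennreal (\<epsilon>/2)"
  proof -
    have half: "\<epsilon> / 2 > 0" using \<open>\<epsilon> > 0\<close> by simp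
    have "(\<integral>\<^sup>+x. u x \<partial>M) \<noteq> \<infinity>" using fin by simp
    from SUP_approx_ennreal[OF half UNIV_not_empty eq this] show ?thesis
      by (blast intro: less_imp_le)
  qed
  ultimately show thesis by blast
qed

section \<open>Potentials and polar sets\<close>

definition potential :: "'a measure \<Rightarrow> ('a \<Rightarrow> 'a \<Rightarrow> ennreal) \<Rightarrow> ('a \<Rightarrow> real) \<Rightarrow> 'a \<Rightarrow> ennreal" where
  "potential \<mu> k f x = (\<integral>\<^sup>+y. k x y * ennreal (f y) \<partial>\<mu>)"

definition p_energy :: "'a measure \<Rightarrow> real \<Rightarrow> ('a \<Rightarrow> real) \<Rightarrow> ennreal" where
  "p_energy \<mu> p f = (\<integral>\<^sup>+x. ennreal (f x powr p) \<partial>\<mu>)"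

definition nonneg_functions :: "'a measure \<Rightarrow> ('a \<Rightarrow> real) set" where
  "nonneg_functions \<mu> = {f \<in> borel_measurable \<mu>. \<forall>x. 0 \<le> f x}"

text \<open>
  Vanishing of the \<open>p\<close>-capacity attached to the kernel \<open>k\<close>, spelled out by test functions.
\<close>

definition polar :: "'a measure \<Rightarrow> ('a \<Rightarrow> 'a \<Rightarrow> ennreal) \<Rightarrow> real \<Rightarrow> 'a set \<Rightarrow> bool" where
  "polar \<mu> k p E \<longleftrightarrow> (\<forall>\<epsilon>>0. \<exists>f\<in>nonneg_functions \<mu>.
     p_energy \<mu> p f \<le> ennreal \<epsilon> \<and> (\<forall>x\<in>E. 1 \<le> potential \<mu> k f x))"

lemma potential_mono_AE:
  assumes "AE y in \<mu>. f y \<le> g y"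
  shows "potential \<mu> k f x \<le> potential \<mu> k g x"
  unfolding potential_def using assms
  by (intro nn_integral_mono_AE) (auto elim!: eventually_mono intro!: mult_left_mono ennreal_leI)

lemma potential_add:
  assumes "\<And>y. 0 \<le> f y" "\<And>y. 0 \<le> g y"
  shows "potential \<mu> k f x + potential \<mu> k g x \<le> potential \<mu> k (\<lambda>y. f y + g y) x"
  using nn_integral_superadditive[of \<mu> "\<lambda>y. k x y * ennreal (f y)" "\<lambda>y. k x y * ennreal (g y)"]
  by (simp add: potential_def assms distrib_left)

lemma potential_scale:
  assumes "0 \<le> c"
  shows "ennreal c * potential \<mu> k f x \<le> potential \<mu> k (\<lambda>y. c * f y) x"
  using nn_integral_mult_le[of "ennreal c" \<mu> "\<lambda>y. k x y * ennreal (f y)"] assms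
  by (simp add: potential_def ennreal_mult' mult.left_commute)

lemma p_energy_scale:
  assumes "f \<in> nonneg_functions \<mu>" "0 \<le> c"
  shows "p_energy \<mu> p (\<lambda>y. c * f y) = ennreal (c powr p) * p_energy \<mu> p f"
proof -
  have [measurable]: "f \<in> borel_measurable \<mu>" using assms by (simp add: nonneg_functions_def)
  show ?thesis
    using assms by (simp add: p_energy_def nonneg_functions_def powr_mult ennreal_mult nn_integral_cmult)
qed

text \<open>
  The function \<open>F = (\<Sum>i. (f i)\<^sup>p)\<^bsup>1/p\<^esup>\<close> replaces the pointwise supremum. The series may diverge on a
  null set, where \<open>F\<close> is 0; hence the domination holds only almost everywhere, which potentials do
  not notice.
\<close>

lemma lp_majorant:
  assumes p: "0 < p" and f: "\<And>i::nat. f i \<in> nonneg_functions \<mu>"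
    and fin: "(\<Sum>i. p_energy \<mu> p (f i)) \<le> ennreal B"
  obtains F where "F \<in> nonneg_functions \<mu>" "p_energy \<mu> p F \<le> ennreal B"
    "\<And>i. AE x in \<mu>. f i x \<le> F x" "{x. F x \<noteq> 0} \<subseteq> (\<Union>i. {x. f i x \<noteq> 0})"
proof
  have [measurable]: "f i \<in> borel_measurable \<mu>" for i using f by (simp add: nonneg_functions_def)
  have f0: "0 \<le> f i x" for i x using f by (simp add: nonneg_functions_def)
  define u where "u x = (\<Sum>i. ennreal (f i x powr p))" for x
  define F where "F x = enn2real (u x) powr (1/p)" for x
  have [measurable]: "u \<in> borel_measurable \<mu>" unfolding u_def by measurable
  have [measurable]: "F \<in> borel_measurable \<mu>" unfolding F_def by measurable
  show "F \<in> nonneg_functions \<mu>" by (simp add: nonneg_functions_def) (simp add: F_def)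
  have iu: "(\<integral>\<^sup>+x. u x \<partial>\<mu>) \<le> ennreal B"
    using fin unfolding u_def p_energy_def by (subst nn_integral_suminf) auto
  have "ennreal (F x powr p) \<le> u x" for x
    using p by (cases "u x") (auto simp: F_def powr_powr)
  then have "p_energy \<mu> p F \<le> (\<integral>\<^sup>+x. u x \<partial>\<mu>)"
    unfolding p_energy_def by (intro nn_integral_mono)
  with iu show "p_energy \<mu> p F \<le> ennreal B" by simp
  have AEu: "AE x in \<mu>. u x \<noteq> \<infinity>"
  proof (rule nn_integral_PInf_AE)
    show "(\<integral>\<^sup>+x. u x \<partial>\<mu>) \<noteq> \<infinity>" using le_less_trans[OF iu ennreal_less_top] by simp
  qed simp
  have term_le: "ennreal (f i x powr p) \<le> u x" for i x
  proof -
    have "(\<Sum>i\<in>{i}. ennreal (f i x powr p)) \<le> u x"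
      unfolding u_def by (intro sum_le_suminf) auto
    then show ?thesis by simp
  qed
  show "AE x in \<mu>. f i x \<le> F x" for i
    using AEu
  proof (rule eventually_mono)
    fix x assume ux: "u x \<noteq> \<infinity>"
    then have "f i x powr p \<le> enn2real (u x)"
      using term_le[of i x] ux by (cases "u x") auto
    then have "(f i x powr p) powr (1/p) \<le> F x"
      unfolding F_def using p by (intro powr_mono2) auto
    then show "f i x \<le> F x" using p f0[of i x] by (simp add: powr_powr)
  qed
  show "{x. F x \<noteq> 0} \<subseteq> (\<Union>i. {x. f i x \<noteq> 0})"
  proof
    fix x assume "x \<in> {x. F x \<noteq> 0}"
    moreover have "F x = 0" if "\<And>i. f i x = 0"
      using that p by (simp add: F_def u_def)
    ultimately show "x \<in> (\<Union>i. {x. f i x \<noteq> 0})" by blast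
  qed
qed

lemma suminf_geometric_half: "(\<Sum>i. ennreal (c * (1/2) ^ Suc i)) = ennreal c" if "0 \<le> c"
  using that sums_mult[OF power_half_series, of c] by (intro suminf_ennreal_eq) auto

lemma polar_countable_Union:
  assumes p: "0 < p" and E: "\<And>i::nat. polar \<mu> k p (E i)"
  shows "polar \<mu> k p (\<Union>i. E i)"
  unfolding polar_def
proof (intro allI impI)
  fix \<epsilon> :: real assume \<epsilon>: "\<epsilon> > 0"
  have "\<exists>f. f \<in> nonneg_functions \<mu> \<and> p_energy \<mu> p f \<le> ennreal (\<epsilon> * (1/2) ^ Suc i) \<and>
      (\<forall>x\<in>E i. 1 \<le> potential \<mu> k f x)" for i
    using E[of i, unfolded polar_def, rule_format, of "\<epsilon> * (1/2) ^ Suc i"] \<epsilon> by auto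
  then obtain f where f: "\<And>i. f i \<in> nonneg_functions \<mu>"
      "\<And>i. p_energy \<mu> p (f i) \<le> ennreal (\<epsilon> * (1/2) ^ Suc i)"
      "\<And>i x. x \<in> E i \<Longrightarrow> 1 \<le> potential \<mu> k (f i) x"
    by metis
  have "(\<Sum>i. p_energy \<mu> p (f i)) \<le> (\<Sum>i. ennreal (\<epsilon> * (1/2) ^ Suc i))"
    by (intro suminf_le f summableI)
  also have "\<dots> = ennreal \<epsilon>"
    using \<epsilon> by (intro suminf_geometric_half) simp
  finally have sum: "(\<Sum>i. p_energy \<mu> p (f i)) \<le> ennreal \<epsilon>" .
  obtain F where F: "F \<in> nonneg_functions \<mu>" "p_energy \<mu> p F \<le> ennreal \<epsilon>"
      "\<And>i. AE x in \<mu>. f i x \<le> F x" "{x. F x \<noteq> 0} \<subseteq> (\<Union>i. {x. f i x \<noteq> 0})"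
    using lp_majorant[OF p f(1) sum] by blast
  have "1 \<le> potential \<mu> k F x" if "x \<in> E i" for x i
    using f(3)[OF that] potential_mono_AE[OF F(3)[of i], of k x] by (rule order_trans)
  with F show "\<exists>f\<in>nonneg_functions \<mu>. p_energy \<mu> p f \<le> ennreal \<epsilon> \<and> (\<forall>x\<in>\<Union>i. E i. 1 \<le> potential \<mu> k f x)"
    by auto
qed

lemma polar_subset: "polar \<mu> k p E \<Longrightarrow> D \<subseteq> E \<Longrightarrow> polar \<mu> k p D"
  unfolding polar_def by blast

lemma powr_add_le:
  fixes a b :: real
  assumes "0 \<le> a" "0 \<le> b" "0 < p"
  shows "(a + b) powr p \<le> 2 powr p * (a powr p + b powr p)"
proof -
  have "(a + b) powr p \<le> (2 * max a b) powr p" using assms by (intro powr_mono2) auto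
  also have "\<dots> = 2 powr p * max a b powr p" using assms by (simp add: powr_mult)
  also have "\<dots> \<le> 2 powr p * (a powr p + b powr p)"
    by (intro mult_left_mono) (auto simp: max_def)
  finally show ?thesis .
qed

text \<open>
  Off the support of \<open>f\<close> the sum equals \<open>F\<close>, so the crude bound \<open>(a + b)\<^sup>p \<le> 2\<^sup>p (a\<^sup>p + b\<^sup>p)\<close> is needed
  only on the support, where the energy of \<open>F\<close> is small. The energy of \<open>F\<close> thus enters with factor 1,
  which keeps the growth linear when the estimate is iterated.
\<close>

lemma p_energy_add_le:
  assumes p: "1 < p" and "F \<in> nonneg_functions \<mu>" "f \<in> nonneg_functions \<mu>"
    and small: "(\<integral>\<^sup>+x\<in>{x \<in> space \<mu>. f x \<noteq> 0}. ennreal (F x powr p) \<partial>\<mu>) \<le> 1"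
  shows "p_energy \<mu> p (\<lambda>x. F x + f x) \<le> p_energy \<mu> p F + ennreal (2 powr p) * (1 + p_energy \<mu> p f)"
proof -
  have [measurable]: "F \<in> borel_measurable \<mu>" "f \<in> borel_measurable \<mu>"
    and nn: "\<And>x. 0 \<le> F x" "\<And>x. 0 \<le> f x"
    using assms by (auto simp: nonneg_functions_def)
  let ?I = "indicator {x \<in> space \<mu>. f x \<noteq> 0} :: 'a \<Rightarrow> ennreal"
  have "p_energy \<mu> p (\<lambda>x. F x + f x) \<le>
      (\<integral>\<^sup>+x. ennreal (F x powr p) + ennreal (2 powr p) * (ennreal (F x powr p) * ?I x + ennreal (f x powr p)) \<partial>\<mu>)"
    unfolding p_energy_def
  proof (rule nn_integral_mono)
    fix x assume x: "x \<in> space \<mu>"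
    show "ennreal ((F x + f x) powr p) \<le>
      ennreal (F x powr p) + ennreal (2 powr p) * (ennreal (F x powr p) * ?I x + ennreal (f x powr p))"
    proof (cases "f x = 0")
      case True
      then show ?thesis by simp
    next
      case False
      have "ennreal ((F x + f x) powr p) \<le> ennreal (2 powr p * (F x powr p + f x powr p))"
        using nn p by (intro ennreal_leI powr_add_le) auto
      also have "\<dots> = ennreal (2 powr p) * (ennreal (F x powr p) * ?I x + ennreal (f x powr p))"
        using False x by (simp add: ennreal_mult)
      finally show ?thesis by (simp add: add_increasing)
    qed
  qed
  also have "\<dots> = p_energy \<mu> p F + ennreal (2 powr p) *
      ((\<integral>\<^sup>+x\<in>{x \<in> space \<mu>. f x \<noteq> 0}. ennreal (F x powr p) \<partial>\<mu>) + p_energy \<mu> p f)"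
    by (simp add: nn_integral_add nn_integral_cmult p_energy_def)
  also have "\<dots> \<le> p_energy \<mu> p F + ennreal (2 powr p) * (1 + p_energy \<mu> p f)"
    using small by (intro add_left_mono mult_left_mono add_right_mono) auto
  finally show ?thesis .
qed

text \<open>
  The passage from finite to zero capacity. Test functions with shrinking supports are added one by
  one, each support so small that the sum collected so far carries almost no energy on it. The sum of
  \<open>N\<close> of them has energy at most \<open>N K\<close> and potential at least \<open>N\<close>; dividing by \<open>N\<close> leaves energy
  \<open>N\<^bsup>1-p\<^esup> K\<close>, which tends to 0 because \<open>p > 1\<close>.
\<close>

lemma polar_if_shrinking_test_functions:
  assumes p: "1 < p" and B: "0 \<le> B"
    and test: "\<And>\<eta>. \<eta> > 0 \<Longrightarrow> \<exists>f\<in>nonneg_functions \<mu>. p_energy \<mu> p f \<le> ennreal B \<and>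
        emeasure \<mu> {x\<in>space \<mu>. f x \<noteq> 0} \<le> ennreal \<eta> \<and> (\<forall>x\<in>A. 1 \<le> potential \<mu> k f x)"
  shows "polar \<mu> k p A"
proof -
  define K where "K = 2 powr p * (1 + B)"
  have K: "0 < K" using B by (simp add: K_def)
  have sums: "\<exists>F\<in>nonneg_functions \<mu>. p_energy \<mu> p F \<le> ennreal (real N * K) \<and>
      (\<forall>x\<in>A. ennreal (real N) \<le> potential \<mu> k F x)" for N :: nat
  proof (induction N)
    case 0
    show ?case using p
      by (intro bexI[of _ "\<lambda>_. 0"]) (auto simp: nonneg_functions_def p_energy_def)
  next
    case (Suc N)
    then obtain F where F: "F \<in> nonneg_functions \<mu>" "p_energy \<mu> p F \<le> ennreal (real N * K)"
      "\<And>x. x \<in> A \<Longrightarrow> ennreal (real N) \<le> potential \<mu> k F x" by blast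
    then have [measurable]: "F \<in> borel_measurable \<mu>" by (simp add: nonneg_functions_def)
    have "(\<integral>\<^sup>+x. ennreal (F x powr p) \<partial>\<mu>) < \<infinity>"
      using le_less_trans[OF F(2) ennreal_less_top] by (simp add: p_energy_def)
    then obtain \<eta> :: real where \<eta>: "\<eta> > 0" "\<And>T. T \<in> sets \<mu> \<Longrightarrow> emeasure \<mu> T \<le> ennreal \<eta> \<Longrightarrow>
        (\<integral>\<^sup>+x\<in>T. ennreal (F x powr p) \<partial>\<mu>) \<le> ennreal 1"
      using nn_integral_small_on_small_sets[of "\<lambda>x. ennreal (F x powr p)" \<mu> 1] by auto
    obtain f where f: "f \<in> nonneg_functions \<mu>" "p_energy \<mu> p f \<le> ennreal B"
      "emeasure \<mu> {x\<in>space \<mu>. f x \<noteq> 0} \<le> ennreal \<eta>" "\<And>x. x \<in> A \<Longrightarrow> 1 \<le> potential \<mu> k f x"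
      using test[OF \<eta>(1)] by blast
    from f have [measurable]: "f \<in> borel_measurable \<mu>" by (simp add: nonneg_functions_def)
    have "p_energy \<mu> p (\<lambda>x. F x + f x) \<le> p_energy \<mu> p F + ennreal (2 powr p) * (1 + p_energy \<mu> p f)"
      using \<eta>(2)[OF _ f(3)] by (intro p_energy_add_le p F f) simp
    also have "\<dots> \<le> ennreal (real N * K) + ennreal (2 powr p) * (1 + ennreal B)"
      by (intro add_mono mult_left_mono F f) auto
    also have "\<dots> = ennreal (real (Suc N) * K)"
      using B K by (simp add: K_def distrib_right ennreal_mult flip: ennreal_1)
    finally have 1: "p_energy \<mu> p (\<lambda>x. F x + f x) \<le> ennreal (real (Suc N) * K)" .
    have "ennreal (real (Suc N)) \<le> potential \<mu> k (\<lambda>x. F x + f x) x" if "x \<in> A" for x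
    proof -
      have "ennreal (real (Suc N)) = ennreal (real N) + 1" by (simp add: add.commute flip: ennreal_1)
      also have "\<dots> \<le> potential \<mu> k F x + potential \<mu> k f x"
        by (intro add_mono F f that)
      also have "\<dots> \<le> potential \<mu> k (\<lambda>x. F x + f x) x"
        using F(1) f(1) by (intro potential_add) (auto simp: nonneg_functions_def)
      finally show ?thesis .
    qed
    moreover have "(\<lambda>x. F x + f x) \<in> nonneg_functions \<mu>"
      using F(1) f(1) by (auto simp: nonneg_functions_def)
    ultimately show ?case using 1 by (intro bexI[of _ "\<lambda>x. F x + f x"]) auto
  qed
  show ?thesis
    unfolding polar_def
  proof (intro allI impI)
    fix \<epsilon> :: real assume \<epsilon>: "\<epsilon> > 0"
    have "((\<lambda>x::real. x powr (1 - p) * K) \<longlongrightarrow> 0 * K) at_top"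
      using p by (intro tendsto_mult tendsto_const tendsto_neg_powr filterlim_ident) auto
    then have "(\<lambda>N. real N powr (1 - p) * K) \<longlonglongrightarrow> 0"
      using filterlim_compose[OF _ filterlim_real_sequentially] by fastforce
    then have "\<forall>\<^sub>F N in sequentially. real N powr (1 - p) * K < \<epsilon>"
      using \<epsilon> by (auto simp: order_tendsto_iff)
    with eventually_gt_at_top[of 0] have "\<forall>\<^sub>F N in sequentially. real N powr (1 - p) * K < \<epsilon> \<and> 0 < N"
      by eventually_elim simp
    then obtain N where N: "real N powr (1 - p) * K < \<epsilon>" "0 < N"
      using eventually_happens[of _ sequentially] by auto
    obtain F where F: "F \<in> nonneg_functions \<mu>" "p_energy \<mu> p F \<le> ennreal (real N * K)"
      "\<And>x. x \<in> A \<Longrightarrow> ennreal (real N) \<le> potential \<mu> k F x" using sums[of N] by blast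
    define f where "f x = 1 / real N * F x" for x
    have "p_energy \<mu> p f = ennreal ((1 / real N) powr p) * p_energy \<mu> p F"
      unfolding f_def by (rule p_energy_scale[OF F(1)]) simp
    also have "\<dots> \<le> ennreal ((1 / real N) powr p) * ennreal (real N * K)"
      by (intro mult_left_mono F) auto
    also have "\<dots> = ennreal ((1 / real N) powr p * (real N * K))"
      using K by (intro ennreal_mult[symmetric]) auto
    also have "(1 / real N) powr p * (real N * K) = real N powr (1 - p) * K"
      using N by (simp add: powr_diff powr_divide)
    also have "ennreal \<dots> \<le> ennreal \<epsilon>" using N by (intro ennreal_leI) simp
    finally have 1: "p_energy \<mu> p f \<le> ennreal \<epsilon>" .
    have "1 \<le> potential \<mu> k f x" if "x \<in> A" for x
    proof -
      have "1 = ennreal (1 / real N) * ennreal (real N)"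
        using N by (simp flip: ennreal_mult' ennreal_1)
      also have "\<dots> \<le> ennreal (1 / real N) * potential \<mu> k F x"
        by (intro mult_left_mono F that) auto
      also have "\<dots> \<le> potential \<mu> k f x"
        unfolding f_def by (rule potential_scale) simp
      finally show ?thesis .
    qed
    moreover have "f \<in> nonneg_functions \<mu>" using F(1) by (auto simp: nonneg_functions_def f_def[abs_def])
    ultimately show "\<exists>f\<in>nonneg_functions \<mu>. p_energy \<mu> p f \<le> ennreal \<epsilon> \<and> (\<forall>x\<in>A. 1 \<le> potential \<mu> k f x)"
      using 1 by blast
  qed
qed

section \<open>From Hausdorff measure to polarity\<close>

text \<open>
  Each set of a fine cover that meets \<open>A\<close> lies in a ball of radius slightly larger than its diameter,
  centred in \<open>A\<close>. Right continuity of the gauge makes the loss in \<open>h\<close> summable and also covers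
  sets of diameter 0. The energies of the test functions of these balls add up to at most
  \<open>K (M + 2)\<close>, the measures of their supports to an arbitrarily small multiple of \<open>M + 2\<close>.
\<close>

lemma polar_if_hausdorff_premeasure_bounded:
  fixes \<mu> :: "'a::metric_space measure" and h :: "real \<Rightarrow> real"
  assumes \<mu>: "sets \<mu> = sets borel" and p: "1 < p" and K: "0 < K" and M: "0 \<le> M"
    and h: "\<And>t. 0 \<le> t \<Longrightarrow> 0 \<le> h t" "\<And>t. 0 \<le> t \<Longrightarrow> (h \<longlongrightarrow> h t) (at_right t)"
    and test: "\<And>\<eta>. \<eta> > 0 \<Longrightarrow> \<exists>\<delta>>0. \<forall>x\<in>A. \<forall>r. 0 < r \<longrightarrow> r < \<delta> \<longrightarrow>
       (\<exists>f\<in>nonneg_functions \<mu>. p_energy \<mu> p f \<le> ennreal (K * h r) \<and>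
          emeasure \<mu> {y\<in>space \<mu>. f y \<noteq> 0} \<le> ennreal (\<eta> * h r) \<and>
          (\<forall>y\<in>ball x r. 1 \<le> potential \<mu> k f y))"
    and pre: "\<And>\<delta>. \<delta> > 0 \<Longrightarrow> hausdorff_premeasure h \<delta> A \<le> ennreal M"
  shows "polar \<mu> k p A"
proof (rule polar_if_shrinking_test_functions[OF p, where B = "K * (M + 2)"])
  show "0 \<le> K * (M + 2)" using K M by simp
  fix \<eta> :: real assume \<eta>: "\<eta> > 0"
  \<comment> \<open>the gauges of the cover add up to less than \<open>M + 1\<close>, and enlarging the radii costs at most 1\<close>
  define \<eta>' where "\<eta>' = \<eta> / (M + 2)"
  have \<eta>': "\<eta>' > 0" using \<eta> M by (simp add: \<eta>'_def)
  obtain \<delta> where \<delta>: "\<delta> > 0" and tst: "\<And>x r. x \<in> A \<Longrightarrow> 0 < r \<Longrightarrow> r < \<delta> \<Longrightarrow>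
       \<exists>f\<in>nonneg_functions \<mu>. p_energy \<mu> p f \<le> ennreal (K * h r) \<and>
          emeasure \<mu> {y\<in>space \<mu>. f y \<noteq> 0} \<le> ennreal (\<eta>' * h r) \<and>
          (\<forall>y\<in>ball x r. 1 \<le> potential \<mu> k f y)"
    using test[OF \<eta>'] by blast
  have "hausdorff_premeasure h \<delta> A < ennreal (M + 1)"
    using pre[OF \<delta>] M by (auto intro: le_less_trans simp: ennreal_lessI)
  then obtain C :: "nat \<Rightarrow> 'a set" where C: "A \<subseteq> (\<Union>i. C i)"
      "\<And>i. bounded (C i)" "\<And>i. diameter (C i) < \<delta>"
      and Csum: "(\<Sum>i. if C i = {} then 0 else ennreal (h (diameter (C i)))) < ennreal (M + 1)"
    unfolding hausdorff_premeasure_def INF_less_iff by blast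
  define a where "a i = (if C i = {} then 0 else h (diameter (C i))) + 1 * (1/2) ^ Suc i" for i
  have a0: "0 \<le> a i" for i
    unfolding a_def using h(1)[OF diameter_ge_0[OF C(2)[of i]]] by auto
  have "(\<Sum>i. ennreal (a i)) = (\<Sum>i. (if C i = {} then 0 else ennreal (h (diameter (C i)))) + ennreal (1 * (1/2) ^ Suc i))"
  proof (rule arg_cong[where f = suminf], rule ext)
    fix i show "ennreal (a i) = (if C i = {} then 0 else ennreal (h (diameter (C i)))) + ennreal (1 * (1/2) ^ Suc i)"
      unfolding a_def using h(1)[OF diameter_ge_0[OF C(2)[of i]]]
      by (subst ennreal_plus) auto
  qed
  also have "\<dots> = (\<Sum>i. if C i = {} then 0 else ennreal (h (diameter (C i)))) + (\<Sum>i. ennreal (1 * (1/2) ^ Suc i))"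
    by (intro suminf_add[symmetric] summableI)
  also have "\<dots> \<le> ennreal (M + 1) + ennreal 1"
    using suminf_geometric_half[of 1] by (intro add_mono less_imp_le[OF Csum]) (simp only: zero_le_one order_refl)
  also have "\<dots> = ennreal (M + 2)" using M by (subst ennreal_plus[symmetric]) auto
  finally have asum: "(\<Sum>i. ennreal (a i)) \<le> ennreal (M + 2)" .
  have ex: "\<exists>f. f \<in> nonneg_functions \<mu> \<and> p_energy \<mu> p f \<le> ennreal K * ennreal (a i) \<and>
          emeasure \<mu> {y\<in>space \<mu>. f y \<noteq> 0} \<le> ennreal \<eta>' * ennreal (a i) \<and>
          (\<forall>y\<in>A \<inter> C i. 1 \<le> potential \<mu> k f y)" for i
  proof (cases "A \<inter> C i = {}")
    case True
    then show ?thesis using p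
      by (intro exI[of _ "\<lambda>_. 0"]) (auto simp: nonneg_functions_def p_energy_def)
  next
    case False
    then obtain x where x: "x \<in> A" "x \<in> C i" by blast
    let ?t = "diameter (C i)"
    have t0: "0 \<le> ?t" by (rule diameter_ge_0[OF C(2)])
    have "\<forall>\<^sub>F r in at_right ?t. h r < h ?t + (1/2) ^ Suc i"
      using order_tendstoD(2)[OF h(2)[OF t0]] by simp
    moreover have "\<forall>\<^sub>F r in at_right ?t. r \<in> {?t<..<\<delta>}"
      by (rule eventually_at_right_real[OF C(3)])
    ultimately have "\<forall>\<^sub>F r in at_right ?t. h r < h ?t + (1/2) ^ Suc i \<and> r \<in> {?t<..<\<delta>}"
      by eventually_elim blast
    then obtain r where r: "h r < h ?t + (1/2) ^ Suc i" "?t < r" "r < \<delta>"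
      using eventually_happens[of _ "at_right ?t"] by (auto simp: trivial_limit_at_right_real)
    have ha: "h r \<le> a i" "0 < r" using r x t0 by (auto simp: a_def)
    obtain f where f: "f \<in> nonneg_functions \<mu>" "p_energy \<mu> p f \<le> ennreal (K * h r)"
          "emeasure \<mu> {y\<in>space \<mu>. f y \<noteq> 0} \<le> ennreal (\<eta>' * h r)"
          "\<And>y. y \<in> ball x r \<Longrightarrow> 1 \<le> potential \<mu> k f y"
      using tst[OF x(1) ha(2) r(3)] by blast
    have "C i \<subseteq> ball x r"
      using diameter_bounded_bound[OF C(2) x(2)] r(2) by (force simp: mem_ball)
    then have "\<forall>y\<in>A \<inter> C i. 1 \<le> potential \<mu> k f y" using f(4) by blast
    moreover have le: "ennreal (c * h r) \<le> ennreal c * ennreal (a i)" if "0 < c" for c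
      using that ha a0[of i] by (subst ennreal_mult[symmetric]) (auto intro!: ennreal_leI mult_left_mono)
    ultimately show ?thesis
      using f(1) order_trans[OF f(2) le[OF K]] order_trans[OF f(3) le[OF \<eta>']]
      by (intro exI[of _ f]) simp
  qed
  from choice[OF allI[OF ex]] obtain f where f_all: "\<forall>i. f i \<in> nonneg_functions \<mu> \<and>
      p_energy \<mu> p (f i) \<le> ennreal K * ennreal (a i) \<and>
      emeasure \<mu> {y\<in>space \<mu>. f i y \<noteq> 0} \<le> ennreal \<eta>' * ennreal (a i) \<and>
      (\<forall>y\<in>A \<inter> C i. 1 \<le> potential \<mu> k (f i) y)" ..
  then have f: "\<And>i. f i \<in> nonneg_functions \<mu>"
      "\<And>i. p_energy \<mu> p (f i) \<le> ennreal K * ennreal (a i)"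
      "\<And>i. emeasure \<mu> {y\<in>space \<mu>. f i y \<noteq> 0} \<le> ennreal \<eta>' * ennreal (a i)"
      "\<And>i y. y \<in> A \<Longrightarrow> y \<in> C i \<Longrightarrow> 1 \<le> potential \<mu> k (f i) y"
    by blast+
  have scaled_sum: "(\<Sum>i. ennreal c * ennreal (a i)) \<le> ennreal (c * (M + 2))" if "0 < c" for c
    using that asum M by (simp add: ennreal_mult mult_left_mono)
  have "(\<Sum>i. p_energy \<mu> p (f i)) \<le> (\<Sum>i. ennreal K * ennreal (a i))"
    by (intro suminf_le f summableI)
  also note scaled_sum[OF K]
  finally have sum: "(\<Sum>i. p_energy \<mu> p (f i)) \<le> ennreal (K * (M + 2))" .
  have "0 < p" using p by simp
  then obtain F where F: "F \<in> nonneg_functions \<mu>" "p_energy \<mu> p F \<le> ennreal (K * (M + 2))"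
      "\<And>i. AE x in \<mu>. f i x \<le> F x" "{x. F x \<noteq> 0} \<subseteq> (\<Union>i. {x. f i x \<noteq> 0})"
    using lp_majorant[of p f \<mu>, OF _ f(1) sum] by blast
  have [measurable]: "f i \<in> borel_measurable \<mu>" for i using f(1) by (simp add: nonneg_functions_def)
  have "emeasure \<mu> {x\<in>space \<mu>. F x \<noteq> 0} \<le> emeasure \<mu> (\<Union>i. {x\<in>space \<mu>. f i x \<noteq> 0})"
    using F(4) by (intro emeasure_mono) auto
  also have "\<dots> \<le> (\<Sum>i. emeasure \<mu> {x\<in>space \<mu>. f i x \<noteq> 0})"
    by (intro emeasure_subadditive_countably) auto
  also have "\<dots> \<le> (\<Sum>i. ennreal \<eta>' * ennreal (a i))"
    by (intro suminf_le f summableI)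
  also note scaled_sum[OF \<eta>']
  finally have supp: "emeasure \<mu> {x\<in>space \<mu>. F x \<noteq> 0} \<le> ennreal \<eta>"
    using M by (simp add: \<eta>'_def)
  have "1 \<le> potential \<mu> k F x" if x: "x \<in> A" for x
  proof -
    obtain i where "x \<in> C i" using C(1) x by blast
    from f(4)[OF x this] potential_mono_AE[OF F(3)[of i], of k x] show ?thesis by (rule order_trans)
  qed
  with F supp show "\<exists>f\<in>nonneg_functions \<mu>. p_energy \<mu> p f \<le> ennreal (K * (M + 2)) \<and>
      emeasure \<mu> {x\<in>space \<mu>. f x \<noteq> 0} \<le> ennreal \<eta> \<and> (\<forall>x\<in>A. 1 \<le> potential \<mu> k f x)"
    by blast
qed

section \<open>Test functions for balls\<close>

text \<open>
  The infinite diagonal is part of the assumed kernel bound. A real power \<open>0 powr (-s)\<close> would be 0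
  there and would lose it; it matters when \<open>\<mu>\<close> has atoms.
\<close>

definition riesz_kernel :: "real \<Rightarrow> 'a::metric_space \<Rightarrow> 'a \<Rightarrow> ennreal" where
  "riesz_kernel s y z = (if y = z then \<infinity> else ennreal (dist y z powr (-s)))"

text \<open>
  The exponents come from the equality case of Hoelder's inequality: with \<open>\<beta> = s/(p-1)\<close> both
  \<open>w\<^bsup>-s\<^esup> w\<^bsup>-\<beta>\<^esup>\<close> and \<open>(w\<^bsup>-\<beta>\<^esup>)\<^sup>p\<close> equal \<open>w\<^bsup>-sp/(p-1)\<^esup>\<close>, so a single integral \<open>Z\<close> controls potential and
  energy. Truncating the distance at \<open>r\<close> makes the potential estimate uniform over \<open>B(x,r)\<close>.
\<close>

lemma ball_test_function:
  fixes \<mu> :: "'a::metric_space measure"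
  assumes \<mu>: "sets \<mu> = sets borel" and p: "1 < p" and s: "0 < s" and c: "0 < c"
    and r: "0 < r" "r \<le> R" and \<zeta>: "0 < \<zeta>"
    and fin: "emeasure \<mu> (ball x R) < \<infinity>"
    and kernel: "\<And>y z. y \<in> ball x R \<Longrightarrow> z \<in> ball x R \<Longrightarrow> ennreal c * riesz_kernel s y z \<le> k y z"
    and Z: "ennreal \<zeta> \<le> (\<integral>\<^sup>+y\<in>ball x R. ennreal (max (dist x y) r powr (- (s * p / (p - 1)))) \<partial>\<mu>)"
  obtains f where "f \<in> nonneg_functions \<mu>"
    "p_energy \<mu> p f \<le> ennreal ((2 powr s / c) powr p * \<zeta> powr (1 - p))"
    "{y. f y \<noteq> 0} \<subseteq> ball x R" "\<And>y. y \<in> ball x r \<Longrightarrow> 1 \<le> potential \<mu> k f y"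
proof -
  define w where "w y = max (dist x y) r" for y
  have w: "0 < w y" "r \<le> w y" "dist x y \<le> w y" for y using r by (auto simp: w_def)
  have [measurable]: "w \<in> borel_measurable borel"
    unfolding w_def by (intro borel_measurable_continuous_onI continuous_intros)
  note measurable_cong_sets[OF \<mu> refl, simp]
  have [measurable]: "ball x R \<in> sets borel" by simp
  have sp: "space \<mu> = UNIV" using sets_eq_imp_space_eq[OF \<mu>] by simp
  define \<alpha> where "\<alpha> = s * p / (p - 1)"
  define \<beta> where "\<beta> = s / (p - 1)"
  have ab: "\<alpha> = \<beta> * p" "\<alpha> = s + \<beta>" using p by (auto simp: \<alpha>_def \<beta>_def field_simps)
  have \<alpha>: "0 < \<alpha>" using s p by (simp add: \<alpha>_def)
  define Z where "Z = (\<integral>\<^sup>+y\<in>ball x R. ennreal (w y powr (- \<alpha>)) \<partial>\<mu>)"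
  have "Z \<le> (\<integral>\<^sup>+y\<in>ball x R. ennreal (r powr (- \<alpha>)) \<partial>\<mu>)"
    unfolding Z_def using w r \<alpha>
    by (intro nn_integral_mono mult_right_mono ennreal_leI powr_mono2') auto
  also have "\<dots> < \<infinity>"
    using fin by (subst nn_integral_cmult_indicator) (auto simp: \<mu> ennreal_mult_less_top)
  finally obtain z where z: "Z = ennreal z" "0 \<le> z" by (cases Z) auto
  have "ennreal \<zeta> \<le> ennreal z" using assms(10) by (simp add: z(1)[symmetric] Z_def w_def \<alpha>_def)
  then have \<zeta>z: "\<zeta> \<le> z" using z(2) by simp
  with \<zeta> have z0: "0 < z" by simp
  define a where "a = 2 powr s / c / z"
  have a: "0 < a" using c z0 by (simp add: a_def)
  define f where "f y = a * w y powr (- \<beta>) * indicator (ball x R) y" for y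
  show thesis
  proof
    show "f \<in> nonneg_functions \<mu>"
      using a by (auto simp: nonneg_functions_def f_def[abs_def])
    show "{y. f y \<noteq> 0} \<subseteq> ball x R" by (auto simp: f_def indicator_def split: if_splits)
    have "f y powr p = a powr p * (w y powr (- \<alpha>) * indicator (ball x R) y)" for y
      using a p w(1)[of y]
      by (auto simp: f_def indicator_def powr_mult powr_powr ab(1))
    then have "p_energy \<mu> p f = (\<integral>\<^sup>+y. ennreal (a powr p) *
          (ennreal (w y powr (- \<alpha>)) * indicator (ball x R) y) \<partial>\<mu>)"
      unfolding p_energy_def by (intro nn_integral_cong) (auto simp: ennreal_mult indicator_def)
    also have "\<dots> = ennreal (a powr p) * Z"
      unfolding Z_def by (intro nn_integral_cmult) simp
    also have "\<dots> = ennreal (a powr p * z)"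
      using z by (simp add: ennreal_mult)
    also have "a powr p * z = (2 powr s / c) powr p * z powr (1 - p)"
      using c z0 by (simp add: a_def powr_divide powr_mult powr_diff)
    also have "\<dots> \<le> (2 powr s / c) powr p * \<zeta> powr (1 - p)"
      using p \<zeta> \<zeta>z by (intro mult_left_mono powr_mono2') auto
    finally show "p_energy \<mu> p f \<le> ennreal ((2 powr s / c) powr p * \<zeta> powr (1 - p))"
      by (simp add: ennreal_leI)
    fix y assume y: "y \<in> ball x r"
    \<comment> \<open>the distance from any \<open>y\<close> in \<open>B(x,r)\<close> is at most \<open>2 w\<close>, which the factor \<open>2 powr s\<close> in \<open>f\<close> absorbs\<close>
    have le: "ennreal (1 / z) * (ennreal (w u powr (- \<alpha>)) * indicator (ball x R) u) \<le> k y u * ennreal (f u)" for u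
    proof (cases "u \<in> ball x R")
      case u: True
      have yR: "y \<in> ball x R" using y r by simp
      have d: "dist y u \<le> 2 * w u"
        using y w(2,3)[of u] dist_triangle[of y u x] by (simp add: dist_commute)
      have "ennreal (c * (2 * w u) powr (- s)) \<le> ennreal c * riesz_kernel s y u"
        using d c s w(1)[of u]
        by (auto simp: riesz_kernel_def ennreal_mult_top simp flip: ennreal_mult
            intro!: ennreal_leI mult_left_mono powr_mono2')
      also have "\<dots> \<le> k y u" by (rule kernel[OF yR u])
      finally have "ennreal (c * (2 * w u) powr (- s)) * ennreal (f u) \<le> k y u * ennreal (f u)"
        by (rule mult_right_mono) simp
      also have "ennreal (c * (2 * w u) powr (- s)) * ennreal (f u) = ennreal (c * (2 * w u) powr (- s) * f u)"
        using c a by (intro ennreal_mult[symmetric]) (auto simp: f_def)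
      finally have le: "ennreal (c * (2 * w u) powr (- s) * f u) \<le> k y u * ennreal (f u)" .
      have w_add: "w u powr \<alpha> = w u powr s * w u powr \<beta>" by (simp add: ab(2) powr_add)
      have "c * (2 * w u) powr (- s) * f u = 1 / z * w u powr (- \<alpha>)"
        using u c z0 w(1)[of u]
        by (simp add: f_def a_def powr_mult powr_minus w_add field_simps)
      with le have "ennreal (1 / z * w u powr (- \<alpha>)) \<le> k y u * ennreal (f u)" by simp
      then show ?thesis using u z0 by (simp add: ennreal_mult del: times_divide_eq_left)
    qed simp
    have "1 = ennreal (1 / z) * Z" using z z0 by (simp flip: ennreal_mult ennreal_1)
    also have "\<dots> = (\<integral>\<^sup>+u. ennreal (1 / z) * (ennreal (w u powr (- \<alpha>)) * indicator (ball x R) u) \<partial>\<mu>)"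
      unfolding Z_def by (intro nn_integral_cmult[symmetric]) simp
    also have "\<dots> \<le> potential \<mu> k f y"
      unfolding potential_def by (intro nn_integral_mono le)
    finally show "1 \<le> potential \<mu> k f y" .
  qed
qed

text \<open>
  Layer cake: with \<open>w = max (dist x y) r\<close>, \<open>w\<^bsup>-d\<^esup>\<close> dominates the integral of \<open>d t\<^bsup>-d-1\<^esup>\<close> over the \<open>t\<close> in \<open>[r, R]\<close> that exceed the
  distance to \<open>x\<close>. After exchanging the integrals, the volume bound leaves \<open>c d / t\<close>, whose integral
  over \<open>[r, R]\<close> is the logarithm.
\<close>

lemma log_energy_lower_bound:
  fixes \<mu> :: "'a::{metric_space, second_countable_topology} measure"
  assumes \<mu>: "sets \<mu> = sets borel" and d: "0 < d" and c: "0 \<le> c"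
    and r: "0 < r" "r \<le> R"
    and fin: "emeasure \<mu> (ball x R) < \<infinity>"
    and vol: "\<And>t. r \<le> t \<Longrightarrow> t \<le> R \<Longrightarrow> ennreal (c * t powr d) \<le> emeasure \<mu> (ball x t)"
  shows "ennreal (c * d * ln (R / r)) \<le>
    (\<integral>\<^sup>+y\<in>ball x R. ennreal (max (dist x y) r powr (- d)) \<partial>\<mu>)"
proof -
  note measurable_cong_sets[OF \<mu> refl, simp]
  have [measurable]: "ball x t \<in> sets \<mu>" for t by (simp add: \<mu>)
  \<comment> \<open>the restricted measure is finite, so the integrals may be exchanged\<close>
  define \<nu> where "\<nu> = density \<mu> (indicator (ball x R))"
  have sets_\<nu> [measurable_cong]: "sets \<nu> = sets borel" by (simp add: \<nu>_def \<mu>)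
  have \<nu>_ball: "emeasure \<nu> (ball x t) = emeasure \<mu> (ball x t)" if "t \<le> R" for t
  proof -
    have "ball x R \<inter> ball x t = ball x t" using that by auto
    then show ?thesis
      by (simp add: \<nu>_def emeasure_restricted)
  qed
  have "emeasure \<nu> (space \<nu>) < \<infinity>"
    using fin sets_eq_imp_space_eq[OF \<mu>] sets.top[of \<mu>] by (simp add: \<nu>_def emeasure_restricted)
  then interpret \<nu>: finite_measure \<nu> by (intro finite_measureI) simp
  interpret pair_sigma_finite \<nu> lborel ..
  define g where "g t = d * t powr (- d - 1)" for t :: real
  have [measurable]: "g \<in> borel_measurable borel" unfolding g_def by measurable
  define J where "J = (\<lambda>(y, t). ennreal (g t) * indicator {r..R} t * (if dist x y < t then 1 else 0))"
  have [measurable]: "J \<in> borel_measurable (\<nu> \<Otimes>\<^sub>M lborel)" unfolding J_def by measurable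
  \<comment> \<open>integrating in \<open>t\<close> first recovers at most the power of the distance\<close>
  have inner: "(\<integral>\<^sup>+t. J (y, t) \<partial>lborel) \<le> ennreal (max (dist x y) r powr (- d))" if "y \<in> ball x R" for y
  proof -
    define m where "m = max (dist x y) r"
    have m: "0 < m" "m \<le> R" using that r by (auto simp: m_def)
    have "(\<integral>\<^sup>+t. J (y, t) \<partial>lborel) \<le> (\<integral>\<^sup>+t\<in>{m..R}. ennreal (g t) \<partial>lborel)"
      by (intro nn_integral_mono) (auto simp: J_def m_def indicator_def)
    also have "\<dots> = ennreal ((- (R powr (- d))) - (- (m powr (- d))))"
    proof (rule nn_integral_FTC_Icc)
      fix t assume t: "t \<in> {m..R}"
      then show "((\<lambda>t. - (t powr (- d))) has_real_derivative g t) (at t)"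
        using m unfolding g_def by (auto intro!: derivative_eq_intros)
      show "0 \<le> g t" using d by (simp add: g_def)
    qed (use m in auto)
    also have "\<dots> \<le> ennreal (m powr (- d))" by (intro ennreal_leI) simp
    finally show ?thesis by (simp add: m_def)
  qed
  \<comment> \<open>integrating in \<open>y\<close> first brings in the volume of balls\<close>
  have outer: "ennreal (c * d * (1 / t)) \<le> (\<integral>\<^sup>+y. J (y, t) \<partial>\<nu>)" if t: "t \<in> {r..R}" for t
  proof -
    have "(\<integral>\<^sup>+y. J (y, t) \<partial>\<nu>) = (\<integral>\<^sup>+y. ennreal (g t) * indicator (ball x t) y \<partial>\<nu>)"
      using t by (intro nn_integral_cong) (auto simp: J_def indicator_def)
    also have "\<dots> = ennreal (g t) * emeasure \<mu> (ball x t)"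
      using t by (subst nn_integral_cmult_indicator) (auto simp: sets_\<nu> \<nu>_ball)
    finally have "(\<integral>\<^sup>+y. J (y, t) \<partial>\<nu>) = ennreal (g t) * emeasure \<mu> (ball x t)" .
    moreover have "ennreal (g t) * ennreal (c * t powr d) \<le> ennreal (g t) * emeasure \<mu> (ball x t)"
      using t by (intro mult_left_mono vol) auto
    moreover have "ennreal (g t) * ennreal (c * t powr d) = ennreal (g t * (c * t powr d))"
      using c d by (intro ennreal_mult[symmetric]) (auto simp: g_def)
    moreover have "t powr (- d - 1) * t powr d = 1 / t"
      using t r by (simp add: powr_minus_divide flip: powr_add)
    then have "g t * (c * t powr d) = c * d * (1 / t)"
      by (simp add: g_def mult.assoc mult.left_commute)
    ultimately show ?thesis by simp
  qed
  have "ennreal (c * d * ln (R / r)) = ennreal (c * d * ln R - c * d * ln r)"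
    using r by (simp add: ln_div right_diff_distrib)
  also have "\<dots> = (\<integral>\<^sup>+t\<in>{r..R}. ennreal (c * d * (1 / t)) \<partial>lborel)"
    using r c d by (intro nn_integral_FTC_Icc[symmetric]) (auto intro!: derivative_eq_intros)
  also have "\<dots> \<le> (\<integral>\<^sup>+t. \<integral>\<^sup>+y. J (y, t) \<partial>\<nu> \<partial>lborel)"
    using outer by (intro nn_integral_mono) (auto simp: indicator_def)
  also have "\<dots> = (\<integral>\<^sup>+y. \<integral>\<^sup>+t. J (y, t) \<partial>lborel \<partial>\<nu>)"
    by (rule Fubini') simp
  also have "\<dots> = (\<integral>\<^sup>+y. indicator (ball x R) y * (\<integral>\<^sup>+t. J (y, t) \<partial>lborel) \<partial>\<mu>)"
    unfolding \<nu>_def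
  proof (rule nn_integral_density)
    have "(\<lambda>y. \<integral>\<^sup>+t. J (y, t) \<partial>lborel) \<in> borel_measurable \<nu>" by measurable
    then show "(\<lambda>y. \<integral>\<^sup>+t. J (y, t) \<partial>lborel) \<in> borel_measurable \<mu>"
      by (simp add: measurable_cong_sets[OF sets_\<nu> refl])
    show "indicator (ball x R) \<in> borel_measurable \<mu>"
      by (intro borel_measurable_indicator) (simp add: \<mu>)
  qed
  also have "\<dots> \<le> (\<integral>\<^sup>+y\<in>ball x R. ennreal (max (dist x y) r powr (- d)) \<partial>\<mu>)"
    using inner by (intro nn_integral_mono) (auto simp: indicator_def)
  finally show ?thesis .
qed

section \<open>Polarity for the power gauge and the logarithmic gauge\<close>

text \<open>
  The upper volume exponent is \<open>d - 2\<close> and not \<open>d\<close>: this is what finiteness of a potential with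
  kernel of order \<open>\<rho>\<^bsup>2-d\<^esup>\<close> provides, and it suffices to make the supports of test functions small.
\<close>

definition volume_kernel_bounds ::
  "'a::metric_space measure \<Rightarrow> ('a \<Rightarrow> 'a \<Rightarrow> ennreal) \<Rightarrow> real \<Rightarrow> real \<Rightarrow> real \<Rightarrow> real \<Rightarrow> 'a \<Rightarrow> bool" where
  "volume_kernel_bounds \<mu> k d c C R x \<longleftrightarrow>
     (\<forall>r. 0 < r \<longrightarrow> r < R \<longrightarrow> ennreal (c * r powr d) \<le> emeasure \<mu> (ball x r) \<and>
        emeasure \<mu> (ball x r) \<le> ennreal (C * r powr (d - 2))) \<and>
     (\<forall>y\<in>ball x R. \<forall>z\<in>ball x R. ennreal c * riesz_kernel (d - 2) y z \<le> k y z)"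

text \<open>
  Test functions supported in the balls of the cover themselves. The support has measure
  \<open>O(r\<^bsup>d-2\<^esup>)\<close>, which is smaller than the gauge by the factor \<open>r\<^bsup>2p-2\<^esup>\<close>.
\<close>

lemma polar_power_gauge:
  fixes \<mu> :: "'a::metric_space measure"
  assumes \<mu>: "sets \<mu> = sets borel" and p: "1 < p" and d: "2 * p < d"
    and c: "0 < c" and R: "0 < R" and M: "0 \<le> M"
    and A: "\<And>x. x \<in> A \<Longrightarrow> volume_kernel_bounds \<mu> k d c C R x"
    and pre: "\<And>\<delta>. \<delta> > 0 \<Longrightarrow> hausdorff_premeasure (\<lambda>r. r powr (d - 2 * p)) \<delta> A \<le> ennreal M"
  shows "polar \<mu> k p A"
proof (rule polar_if_hausdorff_premeasure_bounded[OF \<mu> p _ M _ _ _ pre])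
  define K where "K = (2 powr (d - 2) / c) powr p * c powr (1 - p)"
  show "0 < K" using c by (simp add: K_def)
  show "((\<lambda>r. r powr (d - 2 * p)) \<longlongrightarrow> t powr (d - 2 * p)) (at_right t)" if "0 \<le> t" for t
    using that d
    by (intro tendsto_powr' tendsto_const tendsto_ident_at)
       (auto simp: eventually_at_right_field intro!: exI[of _ "t+1"])
  fix \<eta> :: real assume \<eta>: "0 < \<eta>"
  have "((\<lambda>r. C * r powr (2 * p - 2)) \<longlongrightarrow> C * 0 powr (2 * p - 2)) (at_right 0)"
    using p by (intro tendsto_mult tendsto_const tendsto_powr' tendsto_ident_at)
       (auto simp: eventually_at_right_field intro!: exI[of _ 1])
  then have "\<forall>\<^sub>F r in at_right 0. C * r powr (2 * p - 2) < \<eta>"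
    using \<eta> by (auto simp: order_tendsto_iff)
  moreover have "\<forall>\<^sub>F r in at_right 0. r < R"
    using eventually_at_right_real[OF R] by eventually_elim simp
  ultimately have "\<forall>\<^sub>F r in at_right 0. C * r powr (2 * p - 2) < \<eta> \<and> r < R"
    by eventually_elim simp
  then obtain \<delta> where \<delta>: "\<delta> > 0"
      "\<And>r. 0 < r \<Longrightarrow> r < \<delta> \<Longrightarrow> C * r powr (2 * p - 2) < \<eta> \<and> r < R"
    by (auto simp: eventually_at_right_field)
  have "\<exists>f\<in>nonneg_functions \<mu>. p_energy \<mu> p f \<le> ennreal (K * r powr (d - 2 * p)) \<and>
      emeasure \<mu> {y\<in>space \<mu>. f y \<noteq> 0} \<le> ennreal (\<eta> * r powr (d - 2 * p)) \<and>
      (\<forall>y\<in>ball x r. 1 \<le> potential \<mu> k f y)" if x: "x \<in> A" and r: "0 < r" "r < \<delta>" for x r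
  proof -
    have rR: "r < R" and Cr: "C * r powr (2 * p - 2) < \<eta>" using \<delta>(2)[OF r] by auto
    have lower: "ennreal (c * r powr d) \<le> emeasure \<mu> (ball x r)"
      and upper: "emeasure \<mu> (ball x r) \<le> ennreal (C * r powr (d - 2))"
      and kernel: "\<And>y z. y \<in> ball x r \<Longrightarrow> z \<in> ball x r \<Longrightarrow> ennreal c * riesz_kernel (d - 2) y z \<le> k y z"
      using A[OF x] r rR by (auto simp: volume_kernel_bounds_def)
    define \<alpha> where "\<alpha> = (d - 2) * p / (p - 1)"
    define \<zeta> where "\<zeta> = r powr (- \<alpha>) * (c * r powr d)"
    have \<zeta>0: "0 < \<zeta>" using c r by (simp add: \<zeta>_def)
    have "ennreal \<zeta> = ennreal (r powr (- \<alpha>)) * ennreal (c * r powr d)"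
      unfolding \<zeta>_def using c by (intro ennreal_mult) auto
    also have "\<dots> \<le> ennreal (r powr (- \<alpha>)) * emeasure \<mu> (ball x r)"
      by (intro mult_left_mono lower) auto
    also have "\<dots> = (\<integral>\<^sup>+y\<in>ball x r. ennreal (r powr (- \<alpha>)) \<partial>\<mu>)"
      by (subst nn_integral_cmult_indicator) (auto simp: \<mu>)
    also have "\<dots> = (\<integral>\<^sup>+y\<in>ball x r. ennreal (max (dist x y) r powr (- \<alpha>)) \<partial>\<mu>)"
      by (intro nn_integral_cong) (auto simp: indicator_def max_def)
    finally have Z: "ennreal \<zeta> \<le> \<dots>" .
    have fin: "emeasure \<mu> (ball x r) < \<infinity>"
      using le_less_trans[OF upper ennreal_less_top] by simp
    have "0 < d - 2" using p d by simp
    then obtain f where f: "f \<in> nonneg_functions \<mu>"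
      "p_energy \<mu> p f \<le> ennreal ((2 powr (d - 2) / c) powr p * \<zeta> powr (1 - p))"
      "{y. f y \<noteq> 0} \<subseteq> ball x r" "\<And>y. y \<in> ball x r \<Longrightarrow> 1 \<le> potential \<mu> k f y"
      using ball_test_function[OF \<mu> p _ c r(1) order_refl \<zeta>0 fin kernel Z[unfolded \<alpha>_def]] by blast
    have "(d - \<alpha>) * (1 - p) = d - 2 * p"
      using p by (simp add: \<alpha>_def field_simps)
    moreover have "\<zeta> = c * r powr (d - \<alpha>)"
      using r by (simp add: \<zeta>_def powr_diff powr_minus field_simps)
    ultimately have "\<zeta> powr (1 - p) = c powr (1 - p) * r powr (d - 2 * p)"
      using c by (simp add: powr_mult powr_powr)
    then have 1: "p_energy \<mu> p f \<le> ennreal (K * r powr (d - 2 * p))"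
      using f(2) by (simp add: K_def mult.assoc)
    have "emeasure \<mu> {y\<in>space \<mu>. f y \<noteq> 0} \<le> emeasure \<mu> (ball x r)"
      using f(3) by (intro emeasure_mono) (auto simp: \<mu>)
    also note upper
    also have "r powr (d - 2) = r powr (2 * p - 2) * r powr (d - 2 * p)"
      by (simp flip: powr_add)
    then have "C * r powr (d - 2) \<le> \<eta> * r powr (d - 2 * p)"
      using mult_right_mono[OF less_imp_le[OF Cr], of "r powr (d - 2 * p)"] by simp
    then have "ennreal (C * r powr (d - 2)) \<le> ennreal (\<eta> * r powr (d - 2 * p))" by (rule ennreal_leI)
    finally show ?thesis using f 1 by blast
  qed
  with \<delta>(1) show "\<exists>\<delta>>0. \<forall>x\<in>A. \<forall>r. 0 < r \<longrightarrow> r < \<delta> \<longrightarrow>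
       (\<exists>f\<in>nonneg_functions \<mu>. p_energy \<mu> p f \<le> ennreal (K * r powr (d - 2 * p)) \<and>
          emeasure \<mu> {y\<in>space \<mu>. f y \<noteq> 0} \<le> ennreal (\<eta> * r powr (d - 2 * p)) \<and>
          (\<forall>y\<in>ball x r. 1 \<le> potential \<mu> k f y))"
    by blast
qed auto

lemma log_gauge_right_continuous:
  assumes "1 < p" "0 \<le> t"
  shows "(log_gauge p \<longlongrightarrow> log_gauge p t) (at_right t)"
proof (cases "t = 0")
  case True
  have "filterlim (\<lambda>r::real. 1 + max 0 (ln (1 / r))) at_top (at_right 0)" by real_asymp
  then have "((\<lambda>r. (1 + max 0 (ln (1 / r))) powr (1 - p)) \<longlongrightarrow> 0) (at_right (0::real))"
    using assms by (intro tendsto_neg_powr) auto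
  moreover have "\<forall>\<^sub>F r in at_right 0. (1 + max 0 (ln (1 / r))) powr (1 - p) = log_gauge p r"
    by (auto simp: eventually_at_right_field log_gauge_def intro!: exI[of _ 1])
  ultimately show ?thesis
    using True by (auto simp: log_gauge_def intro: Lim_transform_eventually)
next
  case False
  then have t: "0 < t" using assms by simp
  have "((\<lambda>r. (1 + max 0 (ln (1 / r))) powr (1 - p)) \<longlongrightarrow> (1 + max 0 (ln (1 / t))) powr (1 - p)) (at_right t)"
    using t by (intro tendsto_intros) auto
  moreover have "\<forall>\<^sub>F r in at_right t. (1 + max 0 (ln (1 / r))) powr (1 - p) = log_gauge p r"
    using t by (auto simp: eventually_at_right_field log_gauge_def intro!: exI[of _ "t + 1"])
  ultimately show ?thesis
    using t by (auto simp: log_gauge_def[of p t] intro: Lim_transform_eventually)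
qed

text \<open>
  In the critical case the energy must collect contributions from all scales between \<open>r\<close> and \<open>R\<close>,
  while \<open>R\<close> has to tend to 0 for the supports to shrink. The choice \<open>R = sqrt r\<close> keeps half of the
  logarithm, \<open>ln (R / r) = ln (1 / r) / 2\<close>, and gives supports of measure \<open>O(r\<^bsup>p-1\<^esup>)\<close>, which is smaller
  than the gauge since \<open>r (1 + ln (1 / r))\<close> tends to 0.
\<close>

lemma polar_log_gauge:
  fixes \<mu> :: "'a::{metric_space, second_countable_topology} measure"
  assumes \<mu>: "sets \<mu> = sets borel" and p: "1 < p" and d: "d = 2 * p"
    and c: "0 < c" and R: "0 < R" and M: "0 \<le> M"
    and A: "\<And>x. x \<in> A \<Longrightarrow> volume_kernel_bounds \<mu> k d c C R x"
    and pre: "\<And>\<delta>. \<delta> > 0 \<Longrightarrow> hausdorff_premeasure (log_gauge p) \<delta> A \<le> ennreal M"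
  shows "polar \<mu> k p A"
proof (rule polar_if_hausdorff_premeasure_bounded[OF \<mu> p _ M _ log_gauge_right_continuous[OF p] _ pre])
  define K where "K = (2 powr (d - 2) / c) powr p * (c * d / 4) powr (1 - p)"
  show "0 < K" using c p d by (simp add: K_def)
  show "0 \<le> log_gauge p t" for t by (simp add: log_gauge_def)
  fix \<eta> :: real assume \<eta>: "0 < \<eta>"
  have "((\<lambda>r::real. r * (1 + ln (1 / r))) \<longlongrightarrow> 0) (at_right 0)" by real_asymp
  moreover have "\<forall>\<^sub>F r::real in at_right 0. 0 \<le> r * (1 + ln (1 / r))" by real_asymp
  ultimately have "((\<lambda>r::real. C * (r * (1 + ln (1 / r))) powr (p - 1)) \<longlongrightarrow> C * 0 powr (p - 1)) (at_right 0)"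
    using p by (intro tendsto_mult tendsto_const tendsto_powr') auto
  then have "\<forall>\<^sub>F r::real in at_right 0. C * (r * (1 + ln (1 / r))) powr (p - 1) < \<eta>"
    using \<eta> by (auto simp: order_tendsto_iff)
  moreover have "\<forall>\<^sub>F r::real in at_right 0. r < R\<^sup>2 \<and> r < exp (- 1)"
    using eventually_at_right_real[of 0 "min (R\<^sup>2) (exp (- 1))"] R by (auto elim!: eventually_mono)
  ultimately have "\<forall>\<^sub>F r::real in at_right 0. C * (r * (1 + ln (1 / r))) powr (p - 1) < \<eta> \<and> r < R\<^sup>2 \<and> r < exp (- 1)"
    by eventually_elim simp
  then obtain \<delta> where \<delta>: "\<delta> > 0"
      "\<And>r. 0 < r \<Longrightarrow> r < \<delta> \<Longrightarrow> C * (r * (1 + ln (1 / r))) powr (p - 1) < \<eta> \<and> r < R\<^sup>2 \<and> r < exp (- 1)"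
    by (auto simp: eventually_at_right_field)
  have "\<exists>f\<in>nonneg_functions \<mu>. p_energy \<mu> p f \<le> ennreal (K * log_gauge p r) \<and>
      emeasure \<mu> {y\<in>space \<mu>. f y \<noteq> 0} \<le> ennreal (\<eta> * log_gauge p r) \<and>
      (\<forall>y\<in>ball x r. 1 \<le> potential \<mu> k f y)" if x: "x \<in> A" and r: "0 < r" "r < \<delta>" for x r
  proof -
    have rR: "r < R\<^sup>2" and re: "r < exp (- 1)" and Cr: "C * (r * (1 + ln (1 / r))) powr (p - 1) < \<eta>"
      using \<delta>(2)[OF r] by auto
    have ln1: "1 \<le> ln (1 / r)"
      using r re ln_less_cancel_iff[of r "exp (- 1)"] by (simp add: ln_div)
    define L where "L = 1 + ln (1 / r)"
    have L: "0 < L" "L \<le> 2 * ln (1 / r)" using ln1 by (auto simp: L_def)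
    have gauge: "log_gauge p r = L powr (1 - p)"
      using r ln1 by (simp add: log_gauge_def L_def)
    have r1: "r < 1" using re by (rule less_trans) simp
    define \<rho> where "\<rho> = sqrt r"
    have \<rho>: "0 < \<rho>" "\<rho> < R" "r \<le> \<rho>"
      using r rR r1 R real_sqrt_less_iff[of r "R\<^sup>2"] real_le_rsqrt[of r r]
      by (auto simp: \<rho>_def power2_eq_square intro!: mult_left_le)
    have bounds: "ennreal (c * t powr d) \<le> emeasure \<mu> (ball x t)"
        "emeasure \<mu> (ball x t) \<le> ennreal (C * t powr (d - 2))" if "r \<le> t" "t \<le> \<rho>" for t
      using A[OF x] r \<rho> that by (auto simp: volume_kernel_bounds_def)
    have kernel: "\<And>y z. y \<in> ball x \<rho> \<Longrightarrow> z \<in> ball x \<rho> \<Longrightarrow> ennreal c * riesz_kernel (d - 2) y z \<le> k y z"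
      using A[OF x] \<rho> by (auto simp: volume_kernel_bounds_def)
    have fin: "emeasure \<mu> (ball x \<rho>) < \<infinity>"
      using le_less_trans[OF bounds(2)[OF \<rho>(3) order_refl] ennreal_less_top] by simp
    define \<zeta> where "\<zeta> = c * d / 4 * L"
    have \<zeta>0: "0 < \<zeta>" using c d p L by (simp add: \<zeta>_def)
    have "ln (\<rho> / r) = ln (1 / r) / 2"
      using r \<rho> by (simp add: \<rho>_def ln_div ln_sqrt)
    then have "\<zeta> \<le> c * d * ln (\<rho> / r)"
      using L mult_left_mono[OF L(2), of "c * d / 4"] c d p by (simp add: \<zeta>_def)
    then have "ennreal \<zeta> \<le> ennreal (c * d * ln (\<rho> / r))" by (rule ennreal_leI)
    also have "\<dots> \<le> (\<integral>\<^sup>+y\<in>ball x \<rho>. ennreal (max (dist x y) r powr (- d)) \<partial>\<mu>)"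
      using d p c r \<rho> fin bounds by (intro log_energy_lower_bound[OF \<mu>]) auto
    also have "d = (d - 2) * p / (p - 1)" using p d by (simp add: field_simps)
    finally have Z: "ennreal \<zeta> \<le> (\<integral>\<^sup>+y\<in>ball x \<rho>. ennreal (max (dist x y) r powr (- ((d - 2) * p / (p - 1)))) \<partial>\<mu>)" .
    have "0 < d - 2" using p d by simp
    then obtain f where f: "f \<in> nonneg_functions \<mu>"
      "p_energy \<mu> p f \<le> ennreal ((2 powr (d - 2) / c) powr p * \<zeta> powr (1 - p))"
      "{y. f y \<noteq> 0} \<subseteq> ball x \<rho>" "\<And>y. y \<in> ball x r \<Longrightarrow> 1 \<le> potential \<mu> k f y"
      using ball_test_function[OF \<mu> p _ c r(1) \<rho>(3) \<zeta>0 fin kernel Z] by blast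
    have "\<zeta> powr (1 - p) = (c * d / 4) powr (1 - p) * L powr (1 - p)"
      unfolding \<zeta>_def by (rule powr_mult)
    then have 1: "p_energy \<mu> p f \<le> ennreal (K * log_gauge p r)"
      using f(2) by (simp add: K_def gauge mult.assoc)
    have "emeasure \<mu> {y\<in>space \<mu>. f y \<noteq> 0} \<le> emeasure \<mu> (ball x \<rho>)"
      using f(3) by (intro emeasure_mono) (auto simp: \<mu>)
    also note bounds(2)[OF \<rho>(3) order_refl]
    also have "\<rho> powr (d - 2) = r powr (p - 1)"
    proof -
      have "1 / 2 * (d - 2) = p - 1" using d by simp
      then show ?thesis
        using r by (simp add: \<rho>_def powr_half_sqrt[symmetric] powr_powr del: times_divide_eq_left)
    qed
    also have "C * r powr (p - 1) \<le> \<eta> * log_gauge p r"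
    proof -
      have "C * r powr (p - 1) = C * (r * L) powr (p - 1) * L powr (1 - p)"
        using r L by (simp add: powr_mult mult.assoc flip: powr_add)
      also have "\<dots> \<le> \<eta> * L powr (1 - p)"
        using Cr by (intro mult_right_mono) (auto simp: L_def)
      finally show ?thesis by (simp add: gauge)
    qed
    then have "ennreal (C * r powr (p - 1)) \<le> ennreal (\<eta> * log_gauge p r)" by (rule ennreal_leI)
    finally show ?thesis using f 1 by blast
  qed
  with \<delta>(1) show "\<exists>\<delta>>0. \<forall>x\<in>A. \<forall>r. 0 < r \<longrightarrow> r < \<delta> \<longrightarrow>
       (\<exists>f\<in>nonneg_functions \<mu>. p_energy \<mu> p f \<le> ennreal (K * log_gauge p r) \<and>
          emeasure \<mu> {y\<in>space \<mu>. f y \<noteq> 0} \<le> ennreal (\<eta> * log_gauge p r) \<and>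
          (\<forall>y\<in>ball x r. 1 \<le> potential \<mu> k f y))"
    by blast
qed auto

section \<open>Decomposition into uniformly regular parts\<close>

lemma polar_Union:
  assumes "0 < p" "countable \<A>" and pol: "\<And>E. E \<in> \<A> \<Longrightarrow> polar \<mu> k p E"
  shows "polar \<mu> k p (\<Union>\<A>)"
proof (cases "\<A> = {}")
  case True
  have "(\<lambda>_. 0) \<in> nonneg_functions \<mu>" "p_energy \<mu> p (\<lambda>_. 0) = 0"
    using \<open>0 < p\<close> by (auto simp: nonneg_functions_def p_energy_def)
  then show ?thesis unfolding polar_def True by (auto intro!: bexI[of _ "\<lambda>_. 0"])
next
  case False
  have "polar \<mu> k p (\<Union>i. from_nat_into \<A> i)"
    using False by (intro polar_countable_Union assms(1) pol from_nat_into)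
  then show ?thesis using False assms(2) by (simp add: range_from_nat_into)
qed

text \<open>
  Every positive multiple of the indicator of \<open>V\<close> has infinite potential at these points.
\<close>

lemma polar_if_potential_infinite:
  assumes p: "0 < p" and V: "V \<in> sets \<mu>" "emeasure \<mu> V < \<infinity>"
  shows "polar \<mu> k p {x. (\<integral>\<^sup>+y\<in>V. k x y \<partial>\<mu>) = \<infinity>}"
  unfolding polar_def
proof (intro allI impI)
  fix \<epsilon> :: real assume \<epsilon>: "\<epsilon> > 0"
  obtain m where m: "emeasure \<mu> V = ennreal m" "0 \<le> m" using V(2) by (cases "emeasure \<mu> V") auto
  define a where "a = (\<epsilon> / (m + 1)) powr (1 / p)"
  have a: "0 < a" "a powr p = \<epsilon> / (m + 1)" using \<epsilon> m p by (auto simp: a_def powr_powr)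
  have [measurable]: "V \<in> sets \<mu>" by (rule V)
  define f where "f y = a * indicator V y" for y
  have "f \<in> nonneg_functions \<mu>" using a by (simp add: nonneg_functions_def f_def[abs_def])
  moreover have "p_energy \<mu> p f \<le> ennreal \<epsilon>"
  proof -
    have "p_energy \<mu> p f = (\<integral>\<^sup>+y. ennreal (\<epsilon> / (m + 1)) * indicator V y \<partial>\<mu>)"
      unfolding p_energy_def using a(2) p
      by (intro nn_integral_cong) (auto simp: f_def indicator_def)
    also have "\<dots> = ennreal (\<epsilon> / (m + 1) * m)"
      using \<epsilon> m by (subst nn_integral_cmult_indicator) (auto simp: m(1) simp flip: ennreal_mult)
    also have "\<dots> \<le> ennreal \<epsilon>" using \<epsilon> m by (intro ennreal_leI) (simp add: field_simps)
    finally show ?thesis .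
  qed
  moreover have "1 \<le> potential \<mu> k f x" if "(\<integral>\<^sup>+y\<in>V. k x y \<partial>\<mu>) = \<infinity>" for x
  proof -
    have "potential \<mu> k (indicator V) x = \<infinity>"
      using that by (simp add: potential_def ennreal_indicator)
    then show ?thesis
      using potential_scale[of a \<mu> k "indicator V" x] a
      by (simp add: f_def[abs_def] ennreal_mult_top top_unique)
  qed
  ultimately show "\<exists>f\<in>nonneg_functions \<mu>. p_energy \<mu> p f \<le> ennreal \<epsilon> \<and>
      (\<forall>x\<in>{x. (\<integral>\<^sup>+y\<in>V. k x y \<partial>\<mu>) = \<infinity>}. 1 \<le> potential \<mu> k f x)" by blast
qed

text \<open>
  A ball of large volume would produce a large potential at its centre, because the kernel is at
  least of order \<open>r\<^bsup>-s\<^esup>\<close> on the whole ball.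
\<close>

lemma ball_volume_le_if_potential_finite:
  fixes \<mu> :: "'a::metric_space measure"
  assumes \<mu>: "sets \<mu> = sets borel" and s: "0 < s" and c: "0 < c" and r: "0 < r"
    and V: "ball x r \<subseteq> V"
    and kernel: "\<And>y. y \<in> ball x r \<Longrightarrow> ennreal c * riesz_kernel s x y \<le> k x y"
    and I: "(\<integral>\<^sup>+y\<in>V. k x y \<partial>\<mu>) \<le> ennreal I" "0 \<le> I"
  shows "emeasure \<mu> (ball x r) \<le> ennreal (I / c * r powr s)"
proof -
  have "ennreal (c * r powr (- s)) * emeasure \<mu> (ball x r) =
      (\<integral>\<^sup>+y\<in>ball x r. ennreal (c * r powr (- s)) \<partial>\<mu>)"
    by (subst nn_integral_cmult_indicator) (auto simp: \<mu>)
  also have "\<dots> \<le> (\<integral>\<^sup>+y\<in>V. k x y \<partial>\<mu>)"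
  proof (rule nn_integral_mono)
    fix y
    show "ennreal (c * r powr (- s)) * indicator (ball x r) y \<le> k x y * indicator V y"
    proof (cases "y \<in> ball x r")
      case y: True
      have "ennreal (c * r powr (- s)) \<le> ennreal c * riesz_kernel s x y"
        using y c s r
        by (auto simp: riesz_kernel_def ennreal_mult_top simp flip: ennreal_mult
            intro!: ennreal_leI mult_left_mono powr_mono2')
      also have "\<dots> \<le> k x y" by (rule kernel[OF y])
      finally show ?thesis using y V by auto
    qed simp
  qed
  also note I(1)
  finally have le: "ennreal (c * r powr (- s)) * emeasure \<mu> (ball x r) \<le> ennreal I" .
  have "emeasure \<mu> (ball x r) = ennreal (r powr s / c) * (ennreal (c * r powr (- s)) * emeasure \<mu> (ball x r))"
    using c r by (simp add: powr_minus flip: mult.assoc ennreal_mult)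
  also have "\<dots> \<le> ennreal (r powr s / c) * ennreal I" by (intro mult_left_mono le) auto
  also have "\<dots> = ennreal (I / c * r powr s)"
    using c I(2) by (simp add: mult.commute flip: ennreal_mult)
  finally show ?thesis .
qed

lemma locally_finite_countable_cover:
  fixes \<mu> :: "'a::second_countable_topology measure"
  assumes "\<And>x. \<exists>V. open V \<and> x \<in> V \<and> emeasure \<mu> V < \<infinity>"
  obtains \<V> where "countable \<V>" "\<Union>\<V> = UNIV" "\<And>V. V \<in> \<V> \<Longrightarrow> open V \<and> emeasure \<mu> V < \<infinity>"
proof -
  let ?F = "{V. open V \<and> emeasure \<mu> V < \<infinity>}"
  obtain \<V> where "\<V> \<subseteq> ?F" "countable \<V>" "\<Union>\<V> = \<Union>?F"
    by (rule Lindelof[of ?F]) auto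
  moreover have "\<Union>?F = UNIV" using assms by blast
  ultimately show thesis by (intro that[of \<V>]) auto
qed

text \<open>
  The hypotheses hold with constants depending on the point. Points of infinite potential of some
  member \<open>V\<close> of a countable cover by open sets of finite measure are removed as a polar set; at each
  remaining point the upper volume bound holds too, and rounding the constants to
  \<open>1 / (n + 1)\<close> and \<open>m + 1\<close> leaves countably many parts with uniform constants.
\<close>

lemma polar_if_uniformly_regular_parts_polar:
  fixes \<mu> :: "'a::{metric_space, second_countable_topology} measure"
  assumes \<mu>: "sets \<mu> = sets borel" and fin: "\<And>x. \<exists>V. open V \<and> x \<in> V \<and> emeasure \<mu> V < \<infinity>"
    and p: "0 < p" and d: "2 < d"
    and vol: "\<And>x. x \<in> S \<Longrightarrow> \<exists>c>0. \<forall>\<^sub>F r in at_right 0. ennreal (c * r powr d) \<le> emeasure \<mu> (ball x r)"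
    and kernel: "\<And>x. x \<in> S \<Longrightarrow> \<exists>c>0. \<exists>R>0. \<forall>y\<in>ball x R. \<forall>z\<in>ball x R.
        ennreal c * riesz_kernel (d - 2) y z \<le> k y z"
    and parts: "\<And>A c C R. A \<subseteq> S \<Longrightarrow> 0 < c \<Longrightarrow> 0 < R \<Longrightarrow>
        (\<And>x. x \<in> A \<Longrightarrow> volume_kernel_bounds \<mu> k d c C R x) \<Longrightarrow> polar \<mu> k p A"
  shows "polar \<mu> k p S"
proof -
  obtain \<V> where \<V>: "countable \<V>" "\<Union>\<V> = UNIV" "\<And>V. V \<in> \<V> \<Longrightarrow> open V \<and> emeasure \<mu> V < \<infinity>"
    using locally_finite_countable_cover[OF fin] by blast
  define bad where "bad V = {x. (\<integral>\<^sup>+y\<in>V. k x y \<partial>\<mu>) = \<infinity>}" for V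
  define good where "good = (\<lambda>(n::nat, m::nat).
    {x\<in>S. volume_kernel_bounds \<mu> k d (1 / real (Suc n)) (real (Suc m)) (1 / real (Suc n)) x})"
  have "polar \<mu> k p (\<Union>(bad ` \<V> \<union> range good))"
  proof (rule polar_Union[OF p])
    show "countable (bad ` \<V> \<union> range good)" using \<V>(1) by simp
    fix E assume "E \<in> bad ` \<V> \<union> range good"
    then show "polar \<mu> k p E"
    proof
      assume "E \<in> bad ` \<V>"
      then obtain V where V: "V \<in> \<V>" "E = bad V" by blast
      show ?thesis
        unfolding V(2) bad_def using \<V>(3)[OF V(1)] by (intro polar_if_potential_infinite p) (auto simp: \<mu>)
    next
      assume "E \<in> range good"
      then obtain n m where E: "E = good (n, m)" by auto
      show ?thesis
        unfolding E good_def
        by (rule parts[where c = "1 / real (Suc n)" and C = "real (Suc m)" and R = "1 / real (Suc n)"]) auto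
    qed
  qed
  moreover have "S \<subseteq> \<Union>(bad ` \<V> \<union> range good)"
  proof
    fix x assume x: "x \<in> S"
    have "x \<in> \<Union>\<V>" using \<V>(2) by simp
    then obtain V where V: "V \<in> \<V>" "x \<in> V" by (rule UnionE)
    show "x \<in> \<Union>(bad ` \<V> \<union> range good)"
    proof (cases "x \<in> bad V")
      case True
      then show ?thesis using V(1) by blast
    next
      case False
      then obtain I where I: "(\<integral>\<^sup>+y\<in>V. k x y \<partial>\<mu>) = ennreal I" "0 \<le> I"
        by (cases "\<integral>\<^sup>+y\<in>V. k x y \<partial>\<mu>") (auto simp: bad_def)
      obtain c1 R1 where c1: "0 < c1" "0 < R1" "\<And>r. 0 < r \<Longrightarrow> r < R1 \<Longrightarrow> ennreal (c1 * r powr d) \<le> emeasure \<mu> (ball x r)"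
        using vol[OF x] by (auto simp: eventually_at_right_field)
      obtain c2 R2 where c2: "0 < c2" "0 < R2" "\<And>y z. y \<in> ball x R2 \<Longrightarrow> z \<in> ball x R2 \<Longrightarrow>
          ennreal c2 * riesz_kernel (d - 2) y z \<le> k y z"
        using kernel[OF x] by blast
      obtain R3 where R3: "0 < R3" "ball x R3 \<subseteq> V"
        using \<V>(3)[OF V(1)] V(2) openE by blast
      have "0 < Min {c1, c2, R1, R2, R3}" using c1 c2 R3 by simp
      then obtain n where "inverse (real (Suc n)) < Min {c1, c2, R1, R2, R3}"
        using reals_Archimedean by blast
      then have n: "1 / real (Suc n) < c1" "1 / real (Suc n) < c2" "1 / real (Suc n) < R1"
          "1 / real (Suc n) < R2" "1 / real (Suc n) < R3"
        by (simp_all add: inverse_eq_divide)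
      obtain m where m: "I / c2 \<le> real m" using real_arch_simple by blast
      have "volume_kernel_bounds \<mu> k d (1 / real (Suc n)) (real (Suc m)) (1 / real (Suc n)) x"
        unfolding volume_kernel_bounds_def
      proof (intro conjI allI impI ballI)
        fix r :: real assume r: "0 < r" "r < 1 / real (Suc n)"
        have "ennreal (1 / real (Suc n) * r powr d) \<le> ennreal (c1 * r powr d)"
          using n by (intro ennreal_leI mult_right_mono) auto
        also have "\<dots> \<le> emeasure \<mu> (ball x r)" using r n by (intro c1) auto
        finally show "ennreal (1 / real (Suc n) * r powr d) \<le> emeasure \<mu> (ball x r)" .
        have sub: "ball x r \<subseteq> V" "ball x r \<subseteq> ball x R2"
          using r n R3 by (auto intro: order_trans[OF _ R3(2)])
        have "emeasure \<mu> (ball x r) \<le> ennreal (I / c2 * r powr (d - 2))"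
        proof (rule ball_volume_le_if_potential_finite[OF \<mu> _ c2(1) r(1) sub(1)])
          show "ennreal c2 * riesz_kernel (d - 2) x y \<le> k x y" if "y \<in> ball x r" for y
            using c2(2) sub(2) that by (intro c2(3)) auto
        qed (use d I in auto)
        also have "\<dots> \<le> ennreal (real (Suc m) * r powr (d - 2))"
          using m by (intro ennreal_leI mult_right_mono) auto
        finally show "emeasure \<mu> (ball x r) \<le> ennreal (real (Suc m) * r powr (d - 2))" .
      next
        fix y z assume yz: "y \<in> ball x (1 / real (Suc n))" "z \<in> ball x (1 / real (Suc n))"
        have "ennreal (1 / real (Suc n)) * riesz_kernel (d - 2) y z \<le> ennreal c2 * riesz_kernel (d - 2) y z"
          using n by (intro mult_right_mono ennreal_leI) auto
        also have "\<dots> \<le> k y z" using yz n by (intro c2) (auto intro: less_trans)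
        finally show "ennreal (1 / real (Suc n)) * riesz_kernel (d - 2) y z \<le> k y z" .
      qed
      then have "x \<in> good (n, m)" using x by (simp add: good_def)
      then show ?thesis by blast
    qed
  qed
  ultimately show ?thesis by (rule polar_subset)
qed

section \<open>Hausdorff measure, local hypotheses and capacity\<close>

lemma Lim_at_right_0_antimono:
  fixes f :: "real \<Rightarrow> ennreal"
  assumes anti: "\<And>a b. 0 < a \<Longrightarrow> a \<le> b \<Longrightarrow> f b \<le> f a"
  shows "Lim (at_right 0) f = (SUP r\<in>{0<..}. f r)"
proof (rule tendsto_Lim)
  show "(f \<longlongrightarrow> (SUP r\<in>{0<..}. f r)) (at_right 0)"
  proof (rule order_tendstoI)
    fix a assume "a < (SUP r\<in>{0<..}. f r)"
    then obtain b where b: "0 < b" "a < f b" by (auto simp: less_SUP_iff)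
    have "\<forall>\<^sub>F r in at_right 0. r \<in> {0<..<b}" by (rule eventually_at_right_real[OF b(1)])
    then show "\<forall>\<^sub>F r in at_right 0. a < f r"
      by eventually_elim (use b anti in \<open>auto intro: less_le_trans\<close>)
  next
    fix a assume a: "(SUP r\<in>{0<..}. f r) < a"
    have "\<forall>\<^sub>F r in at_right 0. r \<in> {0<..<1::real}" by (rule eventually_at_right_real) simp
    then show "\<forall>\<^sub>F r in at_right 0. f r < a"
      by eventually_elim (auto intro: le_less_trans[OF SUP_upper a])
  qed
qed simp

text \<open>
  The limit defining the Hausdorff measure is a supremum because the premeasure grows as
  \<open>\<delta>\<close> decreases.
\<close>

lemma hausdorff_premeasure_le_measure:
  assumes "0 < \<delta>" "A \<subseteq> S"
  shows "hausdorff_premeasure h \<delta> A \<le> hausdorff_measure h S"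
proof -
  have "hausdorff_premeasure h \<delta> A \<le> hausdorff_premeasure h \<delta> S"
    unfolding hausdorff_premeasure_def using assms(2) by (intro INF_superset_mono) auto
  also have "\<dots> \<le> (SUP \<delta>\<in>{0<..}. hausdorff_premeasure h \<delta> S)"
    using assms(1) by (intro SUP_upper) simp
  also have "\<dots> = hausdorff_measure h S"
    unfolding hausdorff_measure_def
  proof (rule Lim_at_right_0_antimono[symmetric])
    fix a b :: real assume "0 < a" "a \<le> b"
    then show "hausdorff_premeasure h b S \<le> hausdorff_premeasure h a S"
      unfolding hausdorff_premeasure_def by (intro INF_superset_mono) (auto intro: less_le_trans)
  qed
  finally show ?thesis .
qed

text \<open>
  The infima over shrinking balls increase, so a positive limit gives a positive infimum over one
  ball. On the diagonal, a positive value of the scaled kernel forces the kernel to be infinite.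
\<close>

lemma resolvent_kernel_lower_bound:
  assumes "Lim (at_right 0) (\<lambda>r. INF (y, z) \<in> ball x r \<times> ball x r. scaled_resolvent_kernel \<mu> P l d y z) > 0"
  shows "\<exists>c>0. \<exists>R>0. \<forall>y\<in>ball x R. \<forall>z\<in>ball x R.
    ennreal c * riesz_kernel (d - 2) y z \<le> resolvent_kernel \<mu> P l y z"
proof -
  let ?f = "\<lambda>r. INF (y, z) \<in> ball x r \<times> ball x r. scaled_resolvent_kernel \<mu> P l d y z"
  have "Lim (at_right 0) ?f = (SUP r\<in>{0<..}. ?f r)"
    by (rule Lim_at_right_0_antimono) (auto intro!: INF_superset_mono)
  with assms obtain R where R: "0 < R" "0 < ?f R" by (auto simp: less_SUP_iff)
  obtain c' where c': "0 < c'" "c' < ?f R" using dense[OF R(2)] by blast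
  then obtain c where c: "c' = ennreal c" "0 < c" by (cases c') auto
  have "ennreal c * riesz_kernel (d - 2) y z \<le> resolvent_kernel \<mu> P l y z"
    if "y \<in> ball x R" "z \<in> ball x R" for y z
  proof -
    have "?f R \<le> scaled_resolvent_kernel \<mu> P l d y z"
      by (rule INF_lower2[of "(y, z)"]) (use that in auto)
    then have le: "ennreal c < scaled_resolvent_kernel \<mu> P l d y z" using c' c by simp
    show ?thesis
    proof (cases "y = z")
      case True
      then show ?thesis using le by (auto simp: scaled_resolvent_kernel_def split: if_splits)
    next
      case False
      let ?D = "dist y z powr (d - 2)"
      have D: "0 < ?D" using False by simp
      have "ennreal c * riesz_kernel (d - 2) y z = ennreal (1 / ?D) * ennreal c"
        using False powr_minus_divide[of "dist y z" "d - 2"] by (simp add: riesz_kernel_def mult.commute)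
      also have "\<dots> \<le> ennreal (1 / ?D) * (ennreal ?D * resolvent_kernel \<mu> P l y z)"
        using le False by (intro mult_left_mono) (auto simp: scaled_resolvent_kernel_def)
      also have "\<dots> = resolvent_kernel \<mu> P l y z"
        using D by (simp flip: mult.assoc ennreal_mult)
      finally show ?thesis .
    qed
  qed
  with R(1) c(2) show ?thesis by blast
qed

lemma volume_lower_bound:
  assumes "Liminf (at_right 0) (\<lambda>r. emeasure \<mu> (ball x r) / ennreal (r powr d)) > 0"
  shows "\<exists>c>0. \<forall>\<^sub>F r in at_right 0. ennreal (c * r powr d) \<le> emeasure \<mu> (ball x r)"
proof -
  obtain c' where c': "0 < c'" "c' < Liminf (at_right 0) (\<lambda>r. emeasure \<mu> (ball x r) / ennreal (r powr d))"
    using dense[OF assms] by blast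
  then obtain c where c: "c' = ennreal c" "0 < c" by (cases c') auto
  have "\<forall>\<^sub>F r in at_right 0. c' < emeasure \<mu> (ball x r) / ennreal (r powr d)"
    by (rule less_LiminfD[OF c'(2)])
  moreover have "\<forall>\<^sub>F r in at_right 0. r \<in> {0<..<1::real}" by (rule eventually_at_right_real) simp
  ultimately have "\<forall>\<^sub>F r in at_right 0. ennreal (c * r powr d) \<le> emeasure \<mu> (ball x r)"
  proof eventually_elim
    case (elim r)
    have "ennreal (c * r powr d) = c' * ennreal (r powr d)" using c by (simp add: ennreal_mult)
    also have "\<dots> \<le> emeasure \<mu> (ball x r) / ennreal (r powr d) * ennreal (r powr d)"
      using elim by (intro mult_right_mono) auto
    also have "\<dots> = emeasure \<mu> (ball x r)"
      using elim by (simp add: ennreal_divide_times ennreal_mult_divide_eq)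
    finally show ?case .
  qed
  with c show ?thesis by blast
qed

lemma radon_measure_locally_finite:
  fixes \<mu> :: "'a::metric_space measure"
  assumes "locally compact (UNIV :: 'a set)" "radon_measure \<mu>"
  shows "\<exists>V. open V \<and> x \<in> V \<and> emeasure \<mu> V < \<infinity>"
proof -
  obtain V K where VK: "open V" "x \<in> V" "V \<subseteq> K" "compact K"
    using locally_compactE[OF assms(1)] by (metis UNIV_I open_openin openin_open_eq open_UNIV)
  have "emeasure \<mu> V \<le> emeasure \<mu> K"
    using VK assms(2) by (intro emeasure_mono) (auto simp: radon_measure_def compact_imp_closed)
  also have "\<dots> < \<infinity>" using assms(2) VK(4) by (simp add: radon_measure_def)
  finally show ?thesis using VK by blast
qed

lemma capacity2_eq_0_if_polar:
  assumes p: "0 < p" and pol: "polar \<mu> (resolvent_kernel \<mu> P l) p S"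
  shows "capacity2 \<mu> P l p S = 0"
proof -
  have "capacity2 \<mu> P l p S \<le> 0"
  proof (rule ennreal_le_epsilon)
    fix \<epsilon> :: real assume "0 < \<epsilon>"
    then obtain f where f: "f \<in> nonneg_functions \<mu>" "p_energy \<mu> p f \<le> ennreal \<epsilon>"
        "\<And>x. x \<in> S \<Longrightarrow> 1 \<le> potential \<mu> (resolvent_kernel \<mu> P l) f x"
      using pol unfolding polar_def by blast
    from f(1) have [measurable]: "f \<in> borel_measurable \<mu>" and f0: "\<And>x. 0 \<le> f x"
      by (auto simp: nonneg_functions_def)
    have "(\<integral>\<^sup>+x. ennreal (f x powr p) \<partial>\<mu>) < \<infinity>"
      using le_less_trans[OF f(2) ennreal_less_top] by (simp add: p_energy_def)
    then have int: "integrable \<mu> (\<lambda>x. f x powr p)"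
      by (intro integrableI_nonneg) auto
    then have "f \<in> Lp_space \<mu> p" by (simp add: Lp_space_def f0)
    moreover have "1 \<le> resolvent_op \<mu> P l f x" if "x \<in> S" for x
      using f(3)[OF that] by (simp add: resolvent_op_def potential_def)
    ultimately have "capacity2 \<mu> P l p S \<le> ennreal (Lp_norm \<mu> p f powr p)"
      unfolding capacity2_def by (intro INF_lower) (auto simp: f0)
    also have "Lp_norm \<mu> p f powr p = (\<integral>x. f x powr p \<partial>\<mu>)"
      using p by (simp add: Lp_norm_def powr_powr f0)
    also have "ennreal \<dots> = p_energy \<mu> p f"
      unfolding p_energy_def by (rule nn_integral_eq_integral[OF int, symmetric]) simp
    also note f(2)
    finally show "capacity2 \<mu> P l p S \<le> 0 + ennreal \<epsilon>" by simp
  qed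
  then show ?thesis by simp
qed

theorem lemma4:
  fixes \<mu> :: "'a::{metric_space, second_countable_topology} measure"
    and DL :: "('a \<Rightarrow> real) set"
    and L :: "('a \<Rightarrow> real) \<Rightarrow> ('a \<Rightarrow> real)"
    and P :: "real \<Rightarrow> ('a \<Rightarrow> real) \<Rightarrow> ('a \<Rightarrow> real)"
    and S :: "'a set"
    and l p d :: real
  assumes "locally compact (UNIV :: 'a set)"
    and "radon_measure \<mu>"
    and "full_support \<mu>"
    and "nonpos_self_adjoint \<mu> DL L"
    and "dirichlet_form \<mu> (form_domain \<mu> DL L) (op_form \<mu> DL L)"
    and "regular_form \<mu> (form_domain \<mu> DL L) (op_form \<mu> DL L)"
    and "strongly_local \<mu> (form_domain \<mu> DL L) (op_form \<mu> DL L)"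
    and "admits_carre_du_champ \<mu> (form_domain \<mu> DL L) (op_form \<mu> DL L)"
    and "markov_semigroup_generated_by \<mu> DL L P"
    and "abs_cont_strong_feller \<mu> P"
    and "l > 0"
    and "closed S"
    and "1 < p"
    and "d > 0"
    and "\<And>x. x \<in> S \<Longrightarrow>
           Liminf (at_right 0) (\<lambda>r. emeasure \<mu> (ball x r) / ennreal (r powr d)) > 0"
    and "\<And>x. x \<in> S \<Longrightarrow>
           Lim (at_right 0) (\<lambda>r. INF (y, z) \<in> ball x r \<times> ball x r.
             scaled_resolvent_kernel \<mu> P l d y z) > 0"
  shows "(d > 2 * p \<longrightarrow> hausdorff_measure (\<lambda>r. r powr (d - 2 * p)) S < \<infinity> \<longrightarrow>
            capacity2 \<mu> P l p S = 0) \<and>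
         (d = 2 * p \<longrightarrow> hausdorff_measure (log_gauge p) S < \<infinity> \<longrightarrow>
            capacity2 \<mu> P l p S = 0)"
proof -
  have \<mu>: "sets \<mu> = sets borel" using assms(2) by (simp add: radon_measure_def)
  have p0: "0 < p" using \<open>1 < p\<close> by simp
  let ?g = "resolvent_kernel \<mu> P l"
  have reduction: "capacity2 \<mu> P l p S = 0"
    if d2: "2 < d" and parts: "\<And>A c C R. A \<subseteq> S \<Longrightarrow> 0 < c \<Longrightarrow> 0 < R \<Longrightarrow>
        (\<And>x. x \<in> A \<Longrightarrow> volume_kernel_bounds \<mu> ?g d c C R x) \<Longrightarrow> polar \<mu> ?g p A"
  proof (rule capacity2_eq_0_if_polar[OF p0], rule polar_if_uniformly_regular_parts_polar[OF \<mu> _ p0 d2])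
    show "\<exists>V. open V \<and> x \<in> V \<and> emeasure \<mu> V < \<infinity>" for x
      by (rule radon_measure_locally_finite[OF assms(1,2)])
    fix x assume x: "x \<in> S"
    show "\<exists>c>0. \<forall>\<^sub>F r in at_right 0. ennreal (c * r powr d) \<le> emeasure \<mu> (ball x r)"
      by (rule volume_lower_bound[OF assms(15)[OF x]])
    show "\<exists>c>0. \<exists>R>0. \<forall>y\<in>ball x R. \<forall>z\<in>ball x R. ennreal c * riesz_kernel (d - 2) y z \<le> ?g y z"
      by (rule resolvent_kernel_lower_bound[OF assms(16)[OF x]])
  next
    fix A c C R
    assume "A \<subseteq> S" "0 < c" "0 < R" "\<And>x. x \<in> A \<Longrightarrow> volume_kernel_bounds \<mu> ?g d c C R x"
    then show "polar \<mu> ?g p A" by (rule parts)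
  qed
  have premeasure_bound: "\<exists>M\<ge>0. \<forall>A\<subseteq>S. \<forall>\<delta>>0. hausdorff_premeasure h \<delta> A \<le> ennreal M"
    if "hausdorff_measure h S < \<infinity>" for h
    using that hausdorff_premeasure_le_measure[of _ _ S h] by (cases "hausdorff_measure h S") auto
  show ?thesis
  proof (intro conjI impI)
    assume d: "d > 2 * p" and "hausdorff_measure (\<lambda>r. r powr (d - 2 * p)) S < \<infinity>"
    from premeasure_bound[OF this(2)] obtain M where M: "0 \<le> M"
      "\<And>A \<delta>. A \<subseteq> S \<Longrightarrow> 0 < \<delta> \<Longrightarrow> hausdorff_premeasure (\<lambda>r. r powr (d - 2 * p)) \<delta> A \<le> ennreal M"
      by blast
    show "capacity2 \<mu> P l p S = 0"
    proof (rule reduction)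
      show "2 < d" using d \<open>1 < p\<close> by simp
      fix A c C R
      assume A: "A \<subseteq> S" and "0 < c" "0 < R" "\<And>x. x \<in> A \<Longrightarrow> volume_kernel_bounds \<mu> ?g d c C R x"
      then show "polar \<mu> ?g p A"
        using M(2)[OF A] by (intro polar_power_gauge[OF \<mu> \<open>1 < p\<close> d _ _ M(1), where c = c and C = C and R = R]) auto
    qed
  next
    assume d: "d = 2 * p" and "hausdorff_measure (log_gauge p) S < \<infinity>"
    from premeasure_bound[OF this(2)] obtain M where M: "0 \<le> M"
      "\<And>A \<delta>. A \<subseteq> S \<Longrightarrow> 0 < \<delta> \<Longrightarrow> hausdorff_premeasure (log_gauge p) \<delta> A \<le> ennreal M"
      by blast
    show "capacity2 \<mu> P l p S = 0"
    proof (rule reduction)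
      show "2 < d" using d \<open>1 < p\<close> by simp
      fix A c C R
      assume A: "A \<subseteq> S" and "0 < c" "0 < R" "\<And>x. x \<in> A \<Longrightarrow> volume_kernel_bounds \<mu> ?g d c C R x"
      then show "polar \<mu> ?g p A"
        using M(2)[OF A] by (intro polar_log_gauge[OF \<mu> \<open>1 < p\<close> d _ _ M(1), where c = c and C = C and R = R]) auto
    qed
  qed
qed

end
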